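(* Up to similarity, there is only one isosceles triangle which has exactly two quadrisections, namely the triangle $I_2$ with vertices $(0,0)$, $(1,0)$, $(1/2,8/9)$. That is, $I_2$ has exactly two quadrisections, and every isosceles triangle having exactly two quadrisections is similar to $I_2$.
   Context: A quadrisection of a (nondegenerate, closed) triangle $T$ is an unordered pair of perpendicular segments, each with its endpoints on the boundary of $T$, which intersect in a point in the interior of $T$ and divide $T$ into four regions of equal area. Equilateral triangles are counted as isosceles. *)

theory Defs
  imports "HOL-Analysis.Analysis"
begin

text \<open>Triangles are closed regions of the plane, so that ``similar'' and ``has exactly two
  quadrisections'' are properties of the region and not of a labelling of its vertices.\<close>

definition isosceles_triangle :: "(real^2) set \<Rightarrow> bool" where
  "isosceles_triangle T \<longleftrightarrow>
     (\<exists>a b c. \<not> collinear {a, b, c} \<and> dist a b = dist a c \<and> T = convex hull {a, b, c})"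

definition similarity :: "(real^2 \<Rightarrow> real^2) \<Rightarrow> bool" where
  "similarity f \<longleftrightarrow> (\<exists>k>0. \<forall>x y. dist (f x) (f y) = k * dist x y)"

definition similar :: "(real^2) set \<Rightarrow> (real^2) set \<Rightarrow> bool" where
  "similar S T \<longleftrightarrow> (\<exists>f. similarity f \<and> f ` S = T)"

text \<open>The unordered pair is a two-element set of segments, each segment being a point set. The
  regions into which the segments divide \<open>T\<close> are the connected components of what is left of \<open>T\<close>
  after removing them.\<close>

definition quadrisection :: "(real^2) set \<Rightarrow> (real^2) set set \<Rightarrow> bool" where
  "quadrisection T Q \<longleftrightarrow>
     (\<exists>p q r s. Q = {closed_segment p q, closed_segment r s} \<and>
        p \<noteq> q \<and> r \<noteq> s \<and> {p, q, r, s} \<subseteq> frontier T \<and>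
        orthogonal (q - p) (s - r) \<and>
        (\<exists>x \<in> interior T. closed_segment p q \<inter> closed_segment r s = {x}) \<and>
        (let R = components (T - (closed_segment p q \<union> closed_segment r s)) in
           card R = 4 \<and> (\<forall>C\<in>R. \<forall>D\<in>R. measure lebesgue C = measure lebesgue D)))"

definition I2 :: "(real^2) set" where
  "I2 = convex hull {vector [0, 0], vector [1, 0], vector [1/2, 8/9]}"

end

theory Submission
  imports Defs
begin

text \<open>
  Two chords of a triangle have four endpoints on three sides, and the two ends of a chord lie on
  different sides, so some side \<open>A B\<close> carries an end of each chord. Together with \<open>A B\<close> the two chords
  bound a triangle, which is one of the four regions. Hence the equality of the four areas amounts
  to three equations about triangles (\<open>equal_quarters_iff\<close>): each chord cuts off a corner triangle
  of half the area, and the triangular region has a quarter of the area.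

  Let \<open>u\<close> and \<open>v\<close> be the distances from \<open>B\<close> and from \<open>A\<close> to the two ends on \<open>A B\<close>, in units of that
  side, for the chords that cut off \<open>B\<close> and \<open>A\<close>. The half areas determine the other two ends, and the
  quarter area becomes \<open>4 (u + v - 1)\<^sup>2 = 2 u\<^sup>2 + 2 v\<^sup>2 - 1\<close>, a conic that does not depend on the
  triangle. If both chords cut off the same corner, the areas contradict each other
  (\<open>quarters_not_same_corner\<close>). So the quadrisections are the points of a fixed arc of this conic,
  taken for each of the three sides, at which one further equation, the perpendicularity, holds
  (\<open>quadrisection_triangle_iff\<close>). That equation involves only the lengths of the sides.

  In an isosceles triangle the axis and the perpendicular chord halving the area always form a
  quadrisection. The reflection in the axis permutes the quadrisections and fixes this one. If there
  are exactly two, it fixes the other one as well, and that must then have its triangular region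
  symmetric on the base: \<open>u = v\<close>, which the conic turns into \<open>u = v = 5/6\<close>. Perpendicularity then
  fixes the ratio of leg to base, which is the one of \<open>I2\<close> (\<open>isosceles_two_quadrisections\<close>).
  Conversely, for this ratio the perpendicularity condition on the conic reduces to a polynomial
  equation in \<open>u + v\<close>. In the admissible range it leaves only \<open>u = v = 5/6\<close> on the base
  (\<open>base_cut_unique\<close>) and only the quadrisection along the axis on the legs
  (\<open>leg_cut_unique\<close>).
\<close>

section \<open>Signed areas and triangles in the plane\<close>

definition det2 :: "real^2 \<Rightarrow> real^2 \<Rightarrow> real" where
  "det2 v w = v$1 * w$2 - v$2 * w$1"

text \<open>Twice the signed area of the triangle \<open>a b z\<close>; its sign tells on which side
  of the line \<open>a b\<close> the point \<open>z\<close> lies.\<close>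
definition side :: "real^2 \<Rightarrow> real^2 \<Rightarrow> real^2 \<Rightarrow> real" where
  "side a b z = det2 (b - a) (z - a)"

lemma side_coords:
  "side a b z = (b$1 - a$1) * (z$2 - a$2) - (b$2 - a$2) * (z$1 - a$1)"
  by (simp add: side_def det2_def)

lemma side_cyclic: "side b c a = side a b c" "side c a b = side a b c"
  by (auto simp: side_coords algebra_simps)

lemma side_sum: "side b c z + side c a z + side a b z = side a b c"
  by (simp add: side_coords algebra_simps)

lemma side_barycentric:
  assumes "x + y + t = 1"
  shows "side a b (x *\<^sub>R a + y *\<^sub>R b + t *\<^sub>R c) = t * side a b c"
proof -
  have x: "x = 1 - y - t" using assms by simp
  show ?thesis unfolding x by (simp add: side_coords algebra_simps)
qed

lemma side_affine:
  "side a b ((1 - t) *\<^sub>R z + t *\<^sub>R w) = (1 - t) * side a b z + t * side a b w"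
  by (simp add: side_coords algebra_simps)

text \<open>The barycentric coordinates of \<open>z\<close> are the quotients of the three terms
  \<open>side\<close> by \<open>side a b c\<close>. Multiplying by \<open>side a b c\<close> instead
  of dividing keeps their signs and makes both orientations of the triangle one case.\<close>
lemma convex_hull_triangle_sides:
  assumes D: "side a b c \<noteq> 0"
  shows "convex hull {a, b, c} =
    {z. 0 \<le> side a b c * side a b z \<and> 0 \<le> side a b c * side b c z \<and> 0 \<le> side a b c * side c a z}"
    (is "_ = ?H")
proof (intro equalityI subsetI)
  fix z assume "z \<in> convex hull {a, b, c}"
  then obtain x y t where xyt: "0 \<le> x" "0 \<le> y" "0 \<le> t" "x + y + t = 1"
    and z: "z = x *\<^sub>R a + y *\<^sub>R b + t *\<^sub>R c"
    by (auto simp: convex_hull_3)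
  have "side a b z = t * side a b c" "side b c z = x * side b c a" "side c a z = y * side c a b"
    using side_barycentric[of x y t a b c] side_barycentric[of y t x b c a]
      side_barycentric[of t x y c a b] xyt z by (simp_all add: algebra_simps)
  then show "z \<in> ?H"
    using xyt by (simp add: side_cyclic mult.left_commute)
next
  fix z assume z: "z \<in> ?H"
  let ?D = "side a b c"
  have nn: "0 \<le> side b c z / ?D" "0 \<le> side c a z / ?D" "0 \<le> side a b z / ?D"
    using z D by (auto simp: zero_le_divide_iff zero_le_mult_iff)
  have s: "side b c z / ?D + side c a z / ?D + side a b z / ?D = 1"
    using side_sum[of b c z a] D by (simp add: add_divide_distrib [symmetric])
  have "?D *\<^sub>R z = side b c z *\<^sub>R a + side c a z *\<^sub>R b + side a b z *\<^sub>R c"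
    by (simp add: vec_eq_iff forall_2 side_coords algebra_simps)
  then have "(1 / ?D) *\<^sub>R (?D *\<^sub>R z) = (1 / ?D) *\<^sub>R (side b c z *\<^sub>R a + side c a z *\<^sub>R b + side a b z *\<^sub>R c)"
    by simp
  then have "z = (side b c z / ?D) *\<^sub>R a + (side c a z / ?D) *\<^sub>R b + (side a b z / ?D) *\<^sub>R c"
    using D by (simp add: scaleR_add_right)
  then show "z \<in> convex hull {a, b, c}"
    unfolding convex_hull_3 using nn s by blast
qed

lemma measure_triangle: "measure lebesgue (convex hull {a, b, c :: real^2}) = \<bar>side a b c\<bar> / 2"
proof -
  have "measure lebesgue (convex hull {a, b, c}) = measure lborel (convex hull {a, b, c})"
    by (intro measure_completion) (simp add: borel_compact finite_imp_compact_convex_hull)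
  then show ?thesis
    by (simp add: content_triangle side_coords abs_minus_commute algebra_simps)
qed

lemma side_eq_0_iff:
  assumes "p \<noteq> q"
  shows "side p q z = 0 \<longleftrightarrow> (\<exists>t. z = p + t *\<^sub>R (q - p))"
proof
  assume d: "side p q z = 0"
  have "((q-p) \<bullet> (q-p)) *\<^sub>R (z - p) = ((q-p) \<bullet> (z-p)) *\<^sub>R (q - p)"
    using d unfolding side_coords
    by (simp add: vec_eq_iff forall_2 inner_vec_def sum_2) algebra
  then have "z - p = (((q-p) \<bullet> (z-p)) / ((q-p) \<bullet> (q-p))) *\<^sub>R (q - p)"
    using assms by (simp add: eq_vector_fraction_iff)
  then show "\<exists>t. z = p + t *\<^sub>R (q - p)"
    by (metis add.commute diff_add_cancel)
qed (auto simp: side_coords)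

lemma collinear_iff_side: "collinear {a, b, c :: real^2} \<longleftrightarrow> side a b c = 0"
proof -
  have "collinear {a, b, c} \<longleftrightarrow> collinear {b, a, c}" by (simp add: insert_commute)
  also have "\<dots> \<longleftrightarrow> collinear {0, b - a, c - a}"
    by (rule collinear_3) (simp add: NO_MATCH_def)
  also have "\<dots> \<longleftrightarrow> a = b \<or> (\<exists>t. c = a + t *\<^sub>R (b - a))"
    by (auto simp: collinear_lemma algebra_simps)

  also have "\<dots> \<longleftrightarrow> side a b c = 0"
    by (cases "a = b") (simp_all add: side_eq_0_iff, simp add: side_coords)
  finally show ?thesis .
qed

section \<open>The four sectors cut out by two lines\<close>

text \<open>Only the signs of \<open>\<alpha>\<close> and \<open>\<beta>\<close> matter. Real
  weights allow a side of a line to be selected as the one that contains a given point, without a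
  case distinction on the orientation.\<close>
definition sector :: "(real^2) set \<Rightarrow> (real^2 \<Rightarrow> real) \<Rightarrow> (real^2 \<Rightarrow> real) \<Rightarrow> real \<Rightarrow> real \<Rightarrow> (real^2) set" where
  "sector T f g \<alpha> \<beta> = {z \<in> T. 0 < \<alpha> * f z \<and> 0 < \<beta> * g z}"

definition affine_fun :: "(real^2 \<Rightarrow> real) \<Rightarrow> bool" where
  "affine_fun f \<longleftrightarrow> (\<forall>z w t. f ((1 - t) *\<^sub>R z + t *\<^sub>R w) = (1 - t) * f z + t * f w)"

lemma affine_fun_side: "affine_fun (side a b)"
  by (simp add: affine_fun_def side_affine)

lemma continuous_side [continuous_intros]: "continuous_on S (side a b)"
  unfolding side_coords by (intro continuous_intros)

lemma negligible_side:
  assumes "a \<noteq> b" shows "negligible {z. side a b z = 0}"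
proof -
  define n :: "real^2" where "n = vector [- (b$2 - a$2), b$1 - a$1]"
  have "n \<noteq> 0"
    using assms by (auto simp: n_def vec_eq_iff forall_2)
  moreover have "{z. side a b z = 0} = {z. n \<bullet> z = n \<bullet> a}"
    by (auto simp: n_def side_coords inner_vec_def sum_2 algebra_simps)
  ultimately show ?thesis by (simp add: negligible_hyperplane)
qed

lemma convex_sector:
  assumes "convex T" "affine_fun f" "affine_fun g"
  shows "convex (sector T f g \<alpha> \<beta>)"
  unfolding convex_alt
proof (intro ballI allI impI)
  fix x y u assume x: "x \<in> sector T f g \<alpha> \<beta>" and y: "y \<in> sector T f g \<alpha> \<beta>" and u: "0 \<le> u \<and> u \<le> (1::real)"
  have pos: "0 < (1 - u) * s + u * t" if "0 < s" "0 < t" for s t :: real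
    using that u by (cases "u = 0") (auto simp: add_nonneg_pos)
  have "f ((1 - u) *\<^sub>R x + u *\<^sub>R y) = (1 - u) * f x + u * f y"
    "g ((1 - u) *\<^sub>R x + u *\<^sub>R y) = (1 - u) * g x + u * g y"
    using assms unfolding affine_fun_def by blast+
  then have "\<alpha> * f ((1 - u) *\<^sub>R x + u *\<^sub>R y) = (1 - u) * (\<alpha> * f x) + u * (\<alpha> * f y)"
    "\<beta> * g ((1 - u) *\<^sub>R x + u *\<^sub>R y) = (1 - u) * (\<beta> * g x) + u * (\<beta> * g y)"
    by (simp_all add: distrib_left mult.left_commute)
  then show "(1 - u) *\<^sub>R x + u *\<^sub>R y \<in> sector T f g \<alpha> \<beta>"
    using x y u pos assms(1) by (auto simp: sector_def convex_alt)
qed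

lemma connected_same_sign:
  fixes h :: "'a::topological_space \<Rightarrow> real"
  assumes "connected C" "continuous_on C h" "\<And>z. z \<in> C \<Longrightarrow> h z \<noteq> 0"
    and "x \<in> C" "y \<in> C" "0 < h x"
  shows "0 < h y"
proof (rule ccontr)
  assume "\<not> 0 < h y"
  moreover have "connected (h ` C)" using assms by (simp add: connected_continuous_image)
  ultimately have "0 \<in> h ` C"
    using connectedD_interval[of "h ` C" "h y" "h x" 0] assms by auto
  with assms(3) show False by auto
qed

text \<open>A sector is convex, hence connected, and a connected set on which \<open>f\<close> and
  \<open>g\<close> do not vanish cannot leave it.\<close>
lemma component_sector:
  assumes "convex T" "affine_fun f" "affine_fun g" "continuous_on T f" "continuous_on T g"
    and x: "x \<in> sector T f g \<alpha> \<beta>"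
  shows "connected_component_set (T - {z. f z = 0 \<or> g z = 0}) x = sector T f g \<alpha> \<beta>"
    (is "connected_component_set ?U x = _")
proof
  let ?C = "connected_component_set ?U x"
  have CU: "?C \<subseteq> ?U" by (rule connected_component_subset)
  have xU: "x \<in> ?U" using x by (auto simp: sector_def)
  then have xC: "x \<in> ?C" by simp
  have c: "connected ?C" by simp
  have "continuous_on ?C (\<lambda>z. \<alpha> * f z)" "continuous_on ?C (\<lambda>z. \<beta> * g z)"
    using CU assms by (auto intro!: continuous_intros intro: continuous_on_subset)
  then show "?C \<subseteq> sector T f g \<alpha> \<beta>"
    using connected_same_sign[OF c _ _ xC] CU x unfolding sector_def by force
  show "sector T f g \<alpha> \<beta> \<subseteq> ?C"
    using x convex_connected[OF convex_sector[OF assms(1-3)]]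
    by (intro connected_component_maximal) (auto simp: sector_def)
qed

lemma components_sectors:
  assumes "convex T" "affine_fun f" "affine_fun g" "continuous_on T f" "continuous_on T g"
    and ne: "\<And>\<alpha> \<beta>. \<alpha> \<noteq> 0 \<Longrightarrow> \<beta> \<noteq> 0 \<Longrightarrow> sector T f g \<alpha> \<beta> \<noteq> {}"
  shows "components (T - {z. f z = 0 \<or> g z = 0}) =
      {sector T f g 1 1, sector T f g 1 (-1), sector T f g (-1) 1, sector T f g (-1) (-1)}"
    and "card (components (T - {z. f z = 0 \<or> g z = 0})) = 4"
proof -
  let ?S = "sector T f g" and ?U = "T - {z. f z = 0 \<or> g z = 0}"
  let ?F = "{?S 1 1, ?S 1 (-1), ?S (-1) 1, ?S (-1) (-1)}"
  note comp = component_sector[OF assms(1-5)]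
  show eq: "components ?U = ?F"
  proof (intro equalityI subsetI)
    fix C assume "C \<in> components ?U"
    then obtain x where x: "x \<in> ?U" and C: "C = connected_component_set ?U x" by (rule componentsE)
    have "x \<in> ?S 1 1 \<or> x \<in> ?S 1 (-1) \<or> x \<in> ?S (-1) 1 \<or> x \<in> ?S (-1) (-1)"
      using x by (auto simp: sector_def)
    with C comp show "C \<in> ?F" by blast
  next
    fix C assume "C \<in> ?F"
    then obtain \<alpha> \<beta> where C: "C = ?S \<alpha> \<beta>" "\<alpha> \<noteq> 0" "\<beta> \<noteq> 0" by fastforce
    with ne obtain x where x: "x \<in> ?S \<alpha> \<beta>" by blast
    then have "x \<in> ?U" by (auto simp: sector_def)
    then show "C \<in> components ?U"
      using comp[OF x] C componentsI by metis
  qed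
  have disj: "?S \<alpha> \<beta> \<inter> ?S \<alpha>' \<beta>' = {}" if "\<alpha> = -\<alpha>' \<or> \<beta> = -\<beta>'" for \<alpha> \<beta> \<alpha>' \<beta>'
    using that by (auto simp: sector_def)
  have neq: "?S \<alpha> \<beta> \<noteq> ?S \<alpha>' \<beta>'" if "\<alpha> = -\<alpha>' \<or> \<beta> = -\<beta>'" "\<alpha> \<noteq> 0" "\<beta> \<noteq> 0" for \<alpha> \<beta> \<alpha>' \<beta>'
    using disj[OF that(1)] ne[OF that(2,3)] by blast
  show "card (components ?U) = 4"
    unfolding eq by (simp add: neq)
qed

context
  fixes T :: "(real^2) set" and f g :: "real^2 \<Rightarrow> real"
  assumes T: "compact T" and cf: "continuous_on UNIV f" and cg: "continuous_on UNIV g"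
    and nf: "negligible {z. f z = 0}" and ng: "negligible {z. g z = 0}"
begin

lemma sector_lmeasurable: "sector T f g \<alpha> \<beta> \<in> lmeasurable"
proof -
  have "open {z. 0 < \<alpha> * f z}" "open {z. 0 < \<beta> * g z}"
    using cf cg by (auto intro!: open_Collect_less continuous_intros)
  then have "open ({z. 0 < \<alpha> * f z} \<inter> {z. 0 < \<beta> * g z})" by (rule open_Int)
  then have "T \<inter> ({z. 0 < \<alpha> * f z} \<inter> {z. 0 < \<beta> * g z}) \<in> lmeasurable"
    using T by (intro fmeasurable_Int_fmeasurable lmeasurable_compact) auto
  moreover have "T \<inter> ({z. 0 < \<alpha> * f z} \<inter> {z. 0 < \<beta> * g z}) = sector T f g \<alpha> \<beta>"
    by (auto simp: sector_def)
  ultimately show ?thesis by simp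
qed

text \<open>The zero sets of \<open>f\<close> and \<open>g\<close> are negligible, so weak and
  strict inequalities describe sets of the same area.\<close>
lemma measure_union_sectors:
  assumes fin: "finite I" and I: "I \<subseteq> {1,-1} \<times> {1,-1}"
    and S: "\<And>z. f z \<noteq> 0 \<Longrightarrow> g z \<noteq> 0 \<Longrightarrow> z \<in> S \<longleftrightarrow> (\<exists>(\<alpha>,\<beta>)\<in>I. z \<in> sector T f g \<alpha> \<beta>)"
  shows "measure lebesgue S = (\<Sum>(\<alpha>,\<beta>)\<in>I. measure lebesgue (sector T f g \<alpha> \<beta>))"
proof -
  let ?S = "\<lambda>i. sector T f g (fst i) (snd i)"
  have "measure lebesgue (\<Union>(?S ` I)) = (\<Sum>i\<in>I. measure lebesgue (?S i))"
  proof (rule measure_negligible_finite_Union_image[OF fin])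
    show "?S i \<in> lmeasurable" if "i \<in> I" for i by (rule sector_lmeasurable)
    have "?S i \<inter> ?S j = {}" if "i \<in> I" "j \<in> I" "i \<noteq> j" for i j
    proof -
      have "fst i \<in> {1,-1}" "snd i \<in> {1,-1}" "fst j \<in> {1,-1}" "snd j \<in> {1,-1}"
        using that I by auto
      moreover have "fst i \<noteq> fst j \<or> snd i \<noteq> snd j" using that by (simp add: prod_eq_iff)
      ultimately have "fst i = - fst j \<or> snd i = - snd j" by auto
      then show ?thesis by (auto simp: sector_def)
    qed
    then show "pairwise (\<lambda>i j. negligible (?S i \<inter> ?S j)) I"
      by (auto simp: pairwise_def)
  qed
  moreover have "measure lebesgue S = measure lebesgue (\<Union>(?S ` I))"
  proof (rule measure_negligible_symdiff)
    show "\<Union>(?S ` I) \<in> lmeasurable"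
      using fin sector_lmeasurable by (intro fmeasurable.finite_UN) auto
    have "\<Union>(?S ` I) - S \<union> (S - \<Union>(?S ` I)) \<subseteq> {z. f z = 0} \<union> {z. g z = 0}"
      using S by (force simp: case_prod_beta)
    then show "negligible (\<Union>(?S ` I) - S \<union> (S - \<Union>(?S ` I)))"
      using nf ng by (meson negligible_Un negligible_subset)
  qed
  ultimately show ?thesis by (simp add: case_prod_beta)
qed

text \<open>Two halves and a quarter determine all four areas. The four weights are independent of
  each other: one side of a line has half the area iff the other side has, so each equation can be
  stated for the side that is convenient for it.\<close>
lemma equal_sectors_iff:
  assumes nz: "\<alpha> \<noteq> 0" "\<beta> \<noteq> 0" "\<gamma> \<noteq> 0" "\<delta> \<noteq> 0"
  defines "m \<equiv> measure lebesgue"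
  defines "F \<equiv> {sector T f g 1 1, sector T f g 1 (-1), sector T f g (-1) 1, sector T f g (-1) (-1)}"
  shows "(\<forall>C\<in>F. \<forall>D\<in>F. m C = m D) \<longleftrightarrow>
    m {z \<in> T. 0 \<le> \<alpha> * f z} = m T / 2 \<and> m {z \<in> T. 0 \<le> \<beta> * g z} = m T / 2 \<and>
    m {z \<in> T. 0 \<le> \<gamma> * f z \<and> 0 \<le> \<delta> * g z} = m T / 4"
proof -
  let ?M = "\<lambda>\<alpha> \<beta>. m (sector T f g \<alpha> \<beta>)"
  have sg: "sgn x = 1 \<or> sgn x = -1" if "x \<noteq> 0" for x :: real
    using that by (auto simp: sgn_if)
  have sgn_mult: "0 \<le> x * y \<longleftrightarrow> 0 \<le> sgn x * y" if "x \<noteq> 0" for x y :: real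
    using that by (simp add: zero_le_mult_iff sgn_if)
  have T4: "m T = ?M 1 1 + ?M 1 (-1) + ?M (-1) 1 + ?M (-1) (-1)"
    unfolding m_def
    by (subst measure_union_sectors[of "{(1,1),(1,-1),(-1,1),(-1,-1)}" T]) (auto simp: sector_def)
  have hf: "m {z \<in> T. 0 \<le> a * f z} = ?M a 1 + ?M a (-1)" if "a = 1 \<or> a = -1" for a
    unfolding m_def using that
    by (subst measure_union_sectors[of "{(a,1),(a,-1)}"]) (auto simp: sector_def)
  have hg: "m {z \<in> T. 0 \<le> b * g z} = ?M 1 b + ?M (-1) b" if "b = 1 \<or> b = -1" for b
    unfolding m_def using that
    by (subst measure_union_sectors[of "{(1,b),(-1,b)}"]) (auto simp: sector_def)
  have hfg: "m {z \<in> T. 0 \<le> a * f z \<and> 0 \<le> b * g z} = ?M a b"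
    if "a = 1 \<or> a = -1" "b = 1 \<or> b = -1" for a b
    unfolding m_def using that
    by (subst measure_union_sectors[of "{(a,b)}"]) (auto simp: sector_def)
  have "(\<forall>C\<in>F. \<forall>D\<in>F. m C = m D) \<longleftrightarrow>
     ?M 1 1 = ?M 1 (-1) \<and> ?M 1 1 = ?M (-1) 1 \<and> ?M 1 1 = ?M (-1) (-1)"
    unfolding F_def by auto
  also have "\<dots> \<longleftrightarrow> ?M a 1 + ?M a (-1) = m T / 2 \<and> ?M 1 b + ?M (-1) b = m T / 2 \<and> ?M c d = m T / 4"
    if "a = 1 \<or> a = -1" "b = 1 \<or> b = -1" "c = 1 \<or> c = -1" "d = 1 \<or> d = -1" for a b c d
    using that T4 by (elim disjE) (simp_all only:, argo+)
  finally show ?thesis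
    using sg nz by (simp add: sgn_mult[of \<alpha>] sgn_mult[of \<beta>] sgn_mult[of \<gamma>] sgn_mult[of \<delta>] hf hg hfg)
qed

end

section \<open>Quadrisections as equations between areas\<close>

lemma in_segment_side:
  assumes "x \<in> closed_segment p q" shows "side p q x = 0"
  using assms by (auto simp: in_segment side_affine) (auto simp: side_coords)

text \<open>A point of \<open>T\<close> on the line but beyond \<open>p\<close> would place
  \<open>p\<close> strictly between itself and the interior point \<open>x\<close>, and
  \<open>p\<close> would be interior.\<close>
lemma chord_eq_line:
  fixes T :: "(real^2) set"
  assumes T: "closed T" "convex T" and p: "p \<in> frontier T" and q: "q \<in> frontier T"
    and x: "x \<in> interior T" "x \<in> closed_segment p q"
  shows "{z \<in> T. side p q z = 0} = closed_segment p q"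
proof (intro equalityI subsetI)
  fix z assume z: "z \<in> {z \<in> T. side p q z = 0}"
  have nx: "x \<noteq> p" "x \<noteq> q" using p q x by (auto simp: frontier_def)
  then have pq: "p \<noteq> q" using x by auto
  obtain \<theta> where \<theta>: "x = (1 - \<theta>) *\<^sub>R p + \<theta> *\<^sub>R q" "0 \<le> \<theta>" "\<theta> \<le> 1"
    using x(2) by (auto simp: in_segment)
  with nx have \<theta>01: "0 < \<theta>" "\<theta> < 1" by (auto simp: less_le)
  obtain t where t: "z = p + t *\<^sub>R (q - p)" using z side_eq_0_iff[OF pq] by auto
  have blocked: False if "y \<in> frontier T" "0 < k" "k < 1" "y = (1 - k) *\<^sub>R x + k *\<^sub>R z" "z \<noteq> x" for y k
  proof -
    have "y \<in> open_segment x z" using that by (auto simp: in_segment)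
    moreover have "open_segment x z \<subseteq> interior T"
      using T x z by (intro in_interior_closure_convex_segment) (auto simp: closure_closed)
    ultimately show False using that by (auto simp: frontier_def)
  qed
  have "t \<le> 1"
  proof (rule ccontr)
    assume "\<not> t \<le> 1"
    then have t1: "1 < t" by simp
    define k where "k = (1 - \<theta>) / (t - \<theta>)"
    have k: "k * (t - \<theta>) = 1 - \<theta>" using t1 \<theta>01 by (simp add: k_def)
    have k01: "0 < k" "k < 1" using t1 \<theta>01 by (auto simp: k_def)
    have "(1 - k) *\<^sub>R x + k *\<^sub>R z = p + (\<theta> + k * (t - \<theta>)) *\<^sub>R (q - p)"
      by (simp add: \<theta> t algebra_simps)
    then have "q = (1 - k) *\<^sub>R x + k *\<^sub>R z" by (simp add: k)
    moreover have "z \<noteq> x"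
    proof
      assume "z = x"
      then have "(t - \<theta>) *\<^sub>R (q - p) = 0" by (simp add: \<theta> t algebra_simps)
      with pq t1 \<theta>01 show False by simp
    qed
    ultimately show False using blocked[OF q k01] by simp
  qed
  moreover have "0 \<le> t"
  proof (rule ccontr)
    assume "\<not> 0 \<le> t"
    then have t1: "t < 0" by simp
    define k where "k = \<theta> / (\<theta> - t)"
    have k: "k * (t - \<theta>) = - \<theta>" using t1 \<theta>01 by (simp add: k_def field_simps)
    have k01: "0 < k" "k < 1" using t1 \<theta>01 by (auto simp: k_def)
    have "(1 - k) *\<^sub>R x + k *\<^sub>R z = p + (\<theta> + k * (t - \<theta>)) *\<^sub>R (q - p)"
      by (simp add: \<theta> t algebra_simps)
    then have "p = (1 - k) *\<^sub>R x + k *\<^sub>R z" by (simp add: k)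
    moreover have "z \<noteq> x"
    proof
      assume "z = x"
      then have "(t - \<theta>) *\<^sub>R (q - p) = 0" by (simp add: \<theta> t algebra_simps)
      with pq t1 \<theta>01 show False by simp
    qed
    ultimately show False using blocked[OF p k01] by simp
  qed
  ultimately show "z \<in> closed_segment p q"
    by (auto simp: in_segment t algebra_simps intro!: exI[of _ t])
next
  fix z assume z: "z \<in> closed_segment p q"
  have "p \<in> T" "q \<in> T" using p q T by (auto simp: frontier_def closure_closed)
  then show "z \<in> {z \<in> T. side p q z = 0}"
    using z T closed_segment_subset in_segment_side by blast
qed

text \<open>What a quadrisection requires besides the areas. That the chords are nondegenerate and
  meet only in \<open>x\<close> follows.\<close>
definition crossing :: "(real^2) set \<Rightarrow> real^2 \<Rightarrow> real^2 \<Rightarrow> real^2 \<Rightarrow> real^2 \<Rightarrow> real^2 \<Rightarrow> bool" where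
  "crossing T p q r s x \<longleftrightarrow> {p, q, r, s} \<subseteq> frontier T \<and> x \<in> interior T \<and>
     x \<in> closed_segment p q \<and> x \<in> closed_segment r s \<and> orthogonal (q - p) (s - r)"

definition equal_quarters :: "(real^2) set \<Rightarrow> real^2 \<Rightarrow> real^2 \<Rightarrow> real^2 \<Rightarrow> real^2 \<Rightarrow> bool" where
  "equal_quarters T p q r s \<longleftrightarrow>
     (let F = {sector T (side p q) (side r s) 1 1, sector T (side p q) (side r s) 1 (-1),
        sector T (side p q) (side r s) (-1) 1, sector T (side p q) (side r s) (-1) (-1)}
      in \<forall>C\<in>F. \<forall>D\<in>F. measure lebesgue C = measure lebesgue D)"

lemma crossing_distinct:
  assumes "crossing T p q r s x" shows "x \<noteq> p" "x \<noteq> q" "x \<noteq> r" "x \<noteq> s" "p \<noteq> q" "r \<noteq> s"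
  using assms by (auto simp: crossing_def frontier_def)

lemma segment_diff:
  assumes "x \<in> closed_segment p q" "z \<in> closed_segment p q"
  obtains t :: real where "z - x = t *\<^sub>R (q - p)"
proof -
  obtain a b where ab: "x = (1 - a) *\<^sub>R p + a *\<^sub>R q" "z = (1 - b) *\<^sub>R p + b *\<^sub>R q"
    using assms by (auto simp: in_segment)
  have "z - x = (b - a) *\<^sub>R (q - p)" unfolding ab by (simp add: algebra_simps)
  then show ?thesis using that by blast
qed

lemma crossing_Int:
  assumes "crossing T p q r s x"
  shows "closed_segment p q \<inter> closed_segment r s = {x}"
proof -
  have xpq: "x \<in> closed_segment p q" and xrs: "x \<in> closed_segment r s"
    using assms by (simp_all add: crossing_def)
  have "z = x" if z: "z \<in> closed_segment p q" "z \<in> closed_segment r s" for z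
  proof -
    obtain a where a: "z - x = a *\<^sub>R (q - p)"
      using segment_diff[OF xpq z(1)] .
    obtain b where b: "z - x = b *\<^sub>R (s - r)"
      using segment_diff[OF xrs z(2)] .
    have "(z - x) \<bullet> (z - x) = a * b * ((q - p) \<bullet> (s - r))"
      by (subst a, subst b) simp
    also have "\<dots> = 0" using assms by (simp add: crossing_def orthogonal_def)
    finally show ?thesis by simp
  qed
  with assms show ?thesis by (auto simp: crossing_def)
qed

text \<open>By the identity of Lagrange, \<open>det2\<close> and the inner product of nonzero
  vectors cannot both vanish.\<close>
lemma orthogonal_det2:
  assumes "orthogonal v w" "v \<noteq> 0" "w \<noteq> 0" shows "det2 v w \<noteq> 0"
proof
  assume "det2 v w = 0"
  moreover have "(det2 v w)^2 + (v \<bullet> w)^2 = (v \<bullet> v) * (w \<bullet> w)"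
    by (simp add: det2_def inner_vec_def sum_2) algebra
  ultimately show False using assms by (simp add: orthogonal_def)
qed

text \<open>Around \<open>x\<close> the set \<open>T\<close> contains a disc, and the disc meets all
  four sectors because the chords are not parallel.\<close>
lemma crossing_sector_nonempty:
  assumes c: "crossing T p q r s x" and nz: "\<alpha> \<noteq> 0" "\<beta> \<noteq> 0"
  shows "sector T (side p q) (side r s) \<alpha> \<beta> \<noteq> {}"
proof -
  define K where "K = det2 (q - p) (s - r)"
  have K: "K \<noteq> 0"
    unfolding K_def using c crossing_distinct[OF c]
    by (intro orthogonal_det2) (auto simp: crossing_def)
  \<comment> \<open>Adding \<open>v\<close> to a point changes \<open>side p q\<close> by \<open>\<alpha> K\<^sup>2\<close> and \<open>side r s\<close> by \<open>\<beta> K\<^sup>2\<close>.\<close>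
  define v where "v = (- \<beta> * K) *\<^sub>R (q - p) + (\<alpha> * K) *\<^sub>R (s - r)"
  obtain e where e: "0 < e" "ball x e \<subseteq> T" using c by (auto simp: crossing_def mem_interior)
  define k where "k = e / (2 * (norm v + 1))"
  have k: "0 < k" using e by (simp add: k_def add_nonneg_pos)
  have lt1: "norm v / (2 * (norm v + 1)) < 1"
  proof -
    have "0 \<le> n \<Longrightarrow> n / (2 * (n + 1)) < 1" for n :: real by (simp add: divide_less_eq)
    from this[OF norm_ge_zero] show ?thesis .
  qed
  have "norm (k *\<^sub>R v) < e"
  proof -
    have "norm (k *\<^sub>R v) = e * (norm v / (2 * (norm v + 1)))" using e by (simp add: k_def)
    also have "\<dots> < e * 1" using e
      using lt1 by (intro mult_strict_left_mono) simp_all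
    finally show ?thesis by simp
  qed
  then have zT: "x + k *\<^sub>R v \<in> T" using e by (auto simp: dist_norm)
  have "side p q (x + k *\<^sub>R v) = side p q x + k * (\<alpha> * K * K)"
    by (simp add: side_coords v_def K_def det2_def algebra_simps)
  moreover have "side r s (x + k *\<^sub>R v) = side r s x + k * (\<beta> * K * K)"
    by (simp add: side_coords v_def K_def det2_def algebra_simps)
  moreover have "side p q x = 0" "side r s x = 0"
    using c in_segment_side by (auto simp: crossing_def)
  ultimately have "\<alpha> * side p q (x + k *\<^sub>R v) = k * (\<alpha>^2 * K^2)" "\<beta> * side r s (x + k *\<^sub>R v) = k * (\<beta>^2 * K^2)"
    by (simp_all add: power2_eq_square)
  then have "x + k *\<^sub>R v \<in> sector T (side p q) (side r s) \<alpha> \<beta>"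
    using zT k K nz by (auto simp: sector_def)
  then show ?thesis by blast
qed

text \<open>Inside \<open>T\<close> a chord is the same set as its line, so removing the two chords
  leaves exactly the four sectors.\<close>
lemma quadrisection_iff_equal_quarters:
  assumes T: "compact T" "convex T"
  shows "quadrisection T Q \<longleftrightarrow> (\<exists>p q r s x. Q = {closed_segment p q, closed_segment r s} \<and>
    crossing T p q r s x \<and> equal_quarters T p q r s)"
proof -
  have *: "components (T - (closed_segment p q \<union> closed_segment r s)) =
     {sector T (side p q) (side r s) 1 1, sector T (side p q) (side r s) 1 (-1),
        sector T (side p q) (side r s) (-1) 1, sector T (side p q) (side r s) (-1) (-1)}" (is ?A)
    "card (components (T - (closed_segment p q \<union> closed_segment r s))) = 4" (is ?B)
    if c: "crossing T p q r s x" for p q r s x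
  proof -
    have "{z \<in> T. side p q z = 0} = closed_segment p q" "{z \<in> T. side r s z = 0} = closed_segment r s"
      using chord_eq_line[OF compact_imp_closed[OF T(1)] T(2), of p q x]
        chord_eq_line[OF compact_imp_closed[OF T(1)] T(2), of r s x] c
      by (simp_all add: crossing_def)
    then have eq: "T - (closed_segment p q \<union> closed_segment r s) = T - {z. side p q z = 0 \<or> side r s z = 0}"
      by blast
    note hyps = T(2) affine_fun_side affine_fun_side continuous_side continuous_side
    show ?A unfolding eq
      by (rule components_sectors(1)[OF hyps]) (rule crossing_sector_nonempty[OF c])
    show ?B unfolding eq
      by (rule components_sectors(2)[OF hyps]) (rule crossing_sector_nonempty[OF c])
  qed
  show ?thesis
  proof
    assume "quadrisection T Q"
    then obtain p q r s x where Q: "Q = {closed_segment p q, closed_segment r s}"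
      "{p, q, r, s} \<subseteq> frontier T" "orthogonal (q - p) (s - r)" "x \<in> interior T"
      "closed_segment p q \<inter> closed_segment r s = {x}"
      "\<forall>C\<in>components (T - (closed_segment p q \<union> closed_segment r s)).
        \<forall>D\<in>components (T - (closed_segment p q \<union> closed_segment r s)).
          measure lebesgue C = measure lebesgue D"
      unfolding quadrisection_def Let_def by blast
    then have c: "crossing T p q r s x" by (auto simp: crossing_def)
    have "equal_quarters T p q r s"
      using Q(6) unfolding equal_quarters_def Let_def *(1)[OF c] .
    then show "\<exists>p q r s x. Q = {closed_segment p q, closed_segment r s} \<and>
      crossing T p q r s x \<and> equal_quarters T p q r s" using c Q(1) by blast
  next
    assume "\<exists>p q r s x. Q = {closed_segment p q, closed_segment r s} \<and>
      crossing T p q r s x \<and> equal_quarters T p q r s"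
    then obtain p q r s x where Q: "Q = {closed_segment p q, closed_segment r s}"
      and c: "crossing T p q r s x" and e: "equal_quarters T p q r s" by blast
    have "\<forall>C\<in>components (T - (closed_segment p q \<union> closed_segment r s)).
        \<forall>D\<in>components (T - (closed_segment p q \<union> closed_segment r s)).
          measure lebesgue C = measure lebesgue D"
      using e unfolding equal_quarters_def Let_def *(1)[OF c] .
    then show "quadrisection T Q"
      unfolding quadrisection_def Let_def
      using Q *(2)[OF c] crossing_Int[OF c] crossing_distinct(5,6)[OF c] c[unfolded crossing_def]
      by blast
  qed
qed

lemma equal_quarters_iff:
  assumes "compact T" "p \<noteq> q" "r \<noteq> s" "\<alpha> \<noteq> 0" "\<beta> \<noteq> 0" "\<gamma> \<noteq> 0" "\<delta> \<noteq> 0"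
  shows "equal_quarters T p q r s \<longleftrightarrow>
    measure lebesgue {z \<in> T. 0 \<le> \<alpha> * side p q z} = measure lebesgue T / 2 \<and>
    measure lebesgue {z \<in> T. 0 \<le> \<beta> * side r s z} = measure lebesgue T / 2 \<and>
    measure lebesgue {z \<in> T. 0 \<le> \<gamma> * side p q z \<and> 0 \<le> \<delta> * side r s z} = measure lebesgue T / 4"
  unfolding equal_quarters_def Let_def using assms
  by (intro equal_sectors_iff continuous_side negligible_side)

text \<open>Two of the three half planes that bound \<open>A p q\<close> are those bounding the
  triangle at \<open>A\<close>; the third is the one cut off by the chord.\<close>
lemma corner_triangle:
  assumes D: "side A B C \<noteq> 0" and u: "0 < u" "u \<le> 1" and w: "0 < w" "w \<le> 1"
    and p: "p = A + u *\<^sub>R (B - A)" and q: "q = A + w *\<^sub>R (C - A)"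
  shows "side A p q = u * w * side A B C"
    and "{z \<in> convex hull {A, B, C}. 0 \<le> side A p q * side p q z} = convex hull {A, p, q}"
proof -
  show D': "side A p q = u * w * side A B C"
    by (simp add: p q side_coords algebra_simps)
  have s: "side A p z = u * side A B z" "side q A z = w * side C A z" for z
    by (simp_all add: p q side_coords algebra_simps)
  have D'0: "side A p q \<noteq> 0" using D u w by (simp add: D')
  have nn: "0 \<le> side A p q * (k * y) \<longleftrightarrow> 0 \<le> side A B C * y" if "0 < k" for k y
  proof -
    have "side A p q * (k * y) = (u * w * k) * (side A B C * y)" by (simp add: D')
    moreover have "0 < u * w * k" using u w that by simp
    ultimately show ?thesis by (simp only: zero_le_mult_iff[of "u * w * k"]) linarith
  qed
  have "A \<in> convex hull {A, B, C}" "B \<in> convex hull {A, B, C}" "C \<in> convex hull {A, B, C}"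
    by (auto intro: hull_inc)
  moreover have "p = (1 - u) *\<^sub>R A + u *\<^sub>R B" "q = (1 - w) *\<^sub>R A + w *\<^sub>R C"
    by (simp_all add: p q algebra_simps)
  ultimately have "p \<in> convex hull {A, B, C}" "q \<in> convex hull {A, B, C}"
    using u w by (auto intro!: convexD_alt[OF convex_convex_hull])
  then have sub: "convex hull {A, p, q} \<subseteq> convex hull {A, B, C}"
    using \<open>A \<in> _\<close> by (intro hull_minimal) auto
  have "z \<in> convex hull {A, p, q} \<longleftrightarrow> 0 \<le> side A B C * side A B z \<and> 0 \<le> side A p q * side p q z \<and>
     0 \<le> side A B C * side C A z" for z
    unfolding convex_hull_triangle_sides[OF D'0] using nn[OF u(1)] nn[OF w(1)] by (auto simp: s)
  moreover have "z \<in> convex hull {A, B, C} \<longleftrightarrow> 0 \<le> side A B C * side A B z \<and> 0 \<le> side A B C * side B C z \<and>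
     0 \<le> side A B C * side C A z" for z
    unfolding convex_hull_triangle_sides[OF D] by auto
  ultimately show "{z \<in> convex hull {A, B, C}. 0 \<le> side A p q * side p q z} = convex hull {A, p, q}"
    using sub by blast
qed

lemma half_area_iff:
  assumes "side A B C \<noteq> 0" "0 < u" "u \<le> 1" "0 < w" "w \<le> 1"
    and "p = A + u *\<^sub>R (B - A)" "q = A + w *\<^sub>R (C - A)"
  shows "measure lebesgue {z \<in> convex hull {A, B, C}. 0 \<le> side A p q * side p q z} =
      measure lebesgue (convex hull {A, B, C}) / 2 \<longleftrightarrow> u * w = 1 / 2"
  unfolding corner_triangle(2)[OF assms]
  unfolding measure_triangle corner_triangle(1)[OF assms]
  using assms(1-5) by (simp add: abs_mult mult_ac)

lemma interior_side_pos:
  assumes D: "side A B C \<noteq> 0" and x: "x \<in> interior (convex hull {A, B, C})"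
  shows "0 < side A B C * side A B x"
proof -
  obtain a b c where "0 < a" "0 < b" "0 < c" "a + b + c = 1" and "x = a *\<^sub>R A + b *\<^sub>R B + c *\<^sub>R C"
    using x D by (subst (asm) interior_convex_hull_3_minimal) (auto simp: collinear_iff_side)
  then have "side A B x = c * side A B C" by (simp add: side_barycentric)
  then show ?thesis using D \<open>0 < c\<close> by (simp add: mult.left_commute[of _ c] zero_less_mult_iff[of c]) (auto simp: zero_less_mult_iff)
qed

lemma nonneg_scale: "0 < k \<Longrightarrow> 0 \<le> a * (k * y) \<longleftrightarrow> 0 \<le> a * y" for a k y :: real
  by (simp add: mult.left_commute[of a k] zero_le_mult_iff[of k])

text \<open>The region next to a side that carries an end of each chord is a triangle: its three
  half planes are the one of that side and those of the two chords.\<close>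
lemma base_sector_triangle:
  assumes D: "side A B C \<noteq> 0" and x: "x \<in> interior (convex hull {A, B, C})"
    and p: "p = A + a *\<^sub>R (B - A)" and r: "r = A + b *\<^sub>R (B - A)" and ab: "a \<noteq> b"
    and in_T: "p \<in> convex hull {A, B, C}" "r \<in> convex hull {A, B, C}"
    and t: "0 < t" "x = p + t *\<^sub>R (q - p)" and t': "0 < t'" "x = r + t' *\<^sub>R (s - r)"
  shows "side p r x = (b - a) * side A B x" and "side p r x \<noteq> 0"
    and "{z \<in> convex hull {A, B, C}. 0 \<le> - side p r x * side p q z \<and> 0 \<le> side p r x * side r s z}
      = convex hull {p, r, x}"
proof -
  have pos: "0 < side A B C * side A B x" using interior_side_pos[OF D x] .
  show E: "side p r x = (b - a) * side A B x"
    by (simp add: p r side_coords algebra_simps)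
  show E0: "side p r x \<noteq> 0" using pos ab E by auto
  have pr: "side p r z = (b - a) * side A B z" for z
    by (simp add: p r side_coords algebra_simps)
  have rx: "side r x z = t' * side r s z" for z
    unfolding t'(2) by (simp add: side_coords algebra_simps)
  have xp: "side x p z = - t * side p q z" for z
    unfolding t(2) by (simp add: side_coords algebra_simps)
  have "0 \<le> side p r x * side p r z \<longleftrightarrow> 0 \<le> side A B C * side A B z" for z
  proof -
    have "side p r x * side p r z = (b - a)\<^sup>2 * (side A B x * side A B z)"
      unfolding E pr by (simp add: power2_eq_square)
    moreover have "0 < (b - a)\<^sup>2" using ab by simp
    ultimately have "0 \<le> side p r x * side p r z \<longleftrightarrow> 0 \<le> side A B x * side A B z"
      by (simp add: zero_le_mult_iff)
    then show ?thesis using pos by (auto simp: zero_le_mult_iff zero_less_mult_iff)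
  qed
  moreover have "0 \<le> side p r x * side r x z \<longleftrightarrow> 0 \<le> side p r x * side r s z" for z
    unfolding rx by (rule nonneg_scale[OF t'(1)])
  moreover have "0 \<le> side p r x * side x p z \<longleftrightarrow> 0 \<le> - side p r x * side p q z" for z
    unfolding xp using nonneg_scale[OF t(1), of "- side p r x" "side p q z"] by simp
  ultimately have hull: "z \<in> convex hull {p, r, x} \<longleftrightarrow> 0 \<le> side A B C * side A B z \<and>
      0 \<le> side p r x * side r s z \<and> 0 \<le> - side p r x * side p q z" for z
    unfolding convex_hull_triangle_sides[OF E0] by simp
  have "convex hull {p, r, x} \<subseteq> convex hull {A, B, C}"
    using in_T x interior_subset by (intro hull_minimal) auto
  moreover have "0 \<le> side A B C * side A B z" if "z \<in> convex hull {A, B, C}" for z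
    using that unfolding convex_hull_triangle_sides[OF D] by simp
  ultimately show "{z \<in> convex hull {A, B, C}. 0 \<le> - side p r x * side p q z \<and>
      0 \<le> side p r x * side r s z} = convex hull {p, r, x}"
    using hull by blast
qed

lemma quarter_area_iff:
  assumes "side A B C \<noteq> 0" "x \<in> interior (convex hull {A, B, C})"
    and "p = A + a *\<^sub>R (B - A)" "r = A + b *\<^sub>R (B - A)" "a \<noteq> b"
    and "p \<in> convex hull {A, B, C}" "r \<in> convex hull {A, B, C}"
    and "0 < t" "x = p + t *\<^sub>R (q - p)" "0 < t'" "x = r + t' *\<^sub>R (s - r)"
    and \<eta>: "side A B x = \<eta> * side A B C"
  shows "measure lebesgue {z \<in> convex hull {A, B, C}.
        0 \<le> - side p r x * side p q z \<and> 0 \<le> side p r x * side r s z} =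
      measure lebesgue (convex hull {A, B, C}) / 4 \<longleftrightarrow> \<bar>b - a\<bar> * \<bar>\<eta>\<bar> = 1 / 4"
  unfolding base_sector_triangle(3)[OF assms(1-11)]
  unfolding measure_triangle base_sector_triangle(1)[OF assms(1-11)] \<eta>
  using assms(1) by (simp add: abs_mult mult_ac)

section \<open>The quadrisections of a triangle\<close>

text \<open>Here \<open>u\<close> and \<open>v\<close> locate the two ends on \<open>A B\<close>,
  measured from \<open>B\<close> and from \<open>A\<close>. For the chords of
  \<open>cut_pair\<close>, which halve the area by construction, the quadratic equation says that
  the triangular region has a quarter of the area, and the inner product, in which the directions
  are scaled to be monic in \<open>C - A\<close>, says that the chords are perpendicular. The strict
  inequality makes the chords cross inside and excludes the solution \<open>u = v = 1/2\<close> of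
  the quadratic equation, for which both chords are the same median.\<close>
definition admissible :: "real^2 \<Rightarrow> real^2 \<Rightarrow> real^2 \<Rightarrow> real \<Rightarrow> real \<Rightarrow> bool" where
  "admissible A B C u v \<longleftrightarrow> 1/2 \<le> u \<and> u \<le> 1 \<and> 1/2 \<le> v \<and> v \<le> 1 \<and> 1 < u + v \<and>
     4 * (u + v - 1)\<^sup>2 = 2 * u\<^sup>2 + 2 * v\<^sup>2 - 1 \<and>
     ((2 * u\<^sup>2 - 1) *\<^sub>R (B - A) + (C - A)) \<bullet> ((C - A) - (2 * v\<^sup>2) *\<^sub>R (B - A)) = 0"

definition cut_pair :: "real^2 \<Rightarrow> real^2 \<Rightarrow> real^2 \<Rightarrow> real \<Rightarrow> real \<Rightarrow> (real^2) set set" where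
  "cut_pair A B C u v =
     {closed_segment (B + u *\<^sub>R (A - B)) (B + (1 / (2 * u)) *\<^sub>R (C - B)),
      closed_segment (A + v *\<^sub>R (B - A)) (A + (1 / (2 * v)) *\<^sub>R (C - A))}"

lemma frontier_triangle:
  "frontier (convex hull {A, B, C :: real^2}) = closed_segment A B \<union> closed_segment B C \<union> closed_segment C A"
  by (rule frontier_of_triangle) simp

lemma compact_triangle: "compact (convex hull {A, B, C :: real^2})"
  by (simp add: finite_imp_compact_convex_hull)

lemma frontier_triangle_subset: "frontier (convex hull {A, B, C :: real^2}) \<subseteq> convex hull {A, B, C}"
  by (simp add: compact_triangle compact_imp_closed frontier_subset_closed)

text \<open>A chord with both ends on one side would run inside the boundary and miss the interior
  point \<open>x\<close>.\<close>
lemma crossing_not_on_side: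
  assumes "crossing T p q r s x" "convex K" "K \<subseteq> frontier T" "p \<in> K" "q \<in> K"
  shows False
proof -
  have "closed_segment p q \<subseteq> K" using assms by (simp add: closed_segment_subset)
  then show False using assms by (auto simp: crossing_def frontier_def)
qed

lemma crossing_swap:
  "crossing T p q r s x \<longleftrightarrow> crossing T r s p q x"
  "crossing T p q r s x \<longleftrightarrow> crossing T q p r s x"
  by (auto simp: crossing_def orthogonal_commute closed_segment_commute)
     (auto simp: orthogonal_def inner_diff_left)

lemma in_segment_dir: "x \<in> closed_segment p q \<longleftrightarrow> (\<exists>t\<ge>0. t \<le> 1 \<and> x = p + t *\<^sub>R (q - p))"
  by (auto simp: in_segment algebra_simps)

lemma crossing_params:
  assumes "crossing T p q r s x"
  obtains t t' where "0 < t" "t \<le> 1" "x = p + t *\<^sub>R (q - p)" "0 < t'" "t' \<le> 1" "x = r + t' *\<^sub>R (s - r)"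
proof -
  obtain t where t: "0 \<le> t" "t \<le> 1" "x = p + t *\<^sub>R (q - p)"
    using assms by (auto simp: crossing_def in_segment_dir)
  obtain t' where t': "0 \<le> t'" "t' \<le> 1" "x = r + t' *\<^sub>R (s - r)"
    using assms by (auto simp: crossing_def in_segment_dir)
  have "t \<noteq> 0" "t' \<noteq> 0" using t t' crossing_distinct[OF assms] by auto
  then show ?thesis using that[of t t'] t t' by simp
qed

text \<open>The main computation. With \<open>u\<close>, \<open>w\<close>, \<open>v\<close>,
  \<open>z\<close> the relative positions of the ends and \<open>\<eta>\<close> the height of the
  crossing point over \<open>A B\<close> in units of the height of \<open>C\<close>, the areas give
  \<open>u w = v z = 1/2\<close> and \<open>(u + v - 1) \<eta> = 1/4\<close>, and intersecting the
  chords gives \<open>\<eta> (2 u\<^sup>2 + 2 v\<^sup>2 - 1) = u + v - 1\<close>. Eliminating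
  \<open>\<eta>\<close> yields the conic.\<close>
lemma quarters_base_adjacent:
  assumes D: "side A B C \<noteq> 0"
    and c: "crossing (convex hull {A, B, C}) p q r s x" and e: "equal_quarters (convex hull {A, B, C}) p q r s"
    and on: "p \<in> closed_segment A B" "q \<in> closed_segment B C" "r \<in> closed_segment A B" "s \<in> closed_segment C A"
  shows "\<exists>u v. admissible A B C u v \<and> {closed_segment p q, closed_segment r s} = cut_pair A B C u v"
proof -
  let ?T = "convex hull {A, B, C}" and ?D = "side A B C"
  note ft = frontier_triangle[of A B C]
  obtain u where u: "0 \<le> u" "u \<le> 1" "p = B + u *\<^sub>R (A - B)"
    using on(1) by (metis closed_segment_commute in_segment_dir)
  obtain w where w: "0 \<le> w" "w \<le> 1" "q = B + w *\<^sub>R (C - B)" using on(2) by (auto simp: in_segment_dir)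
  obtain v where v: "0 \<le> v" "v \<le> 1" "r = A + v *\<^sub>R (B - A)" using on(3) by (auto simp: in_segment_dir)
  obtain z where z: "0 \<le> z" "z \<le> 1" "s = A + z *\<^sub>R (C - A)"
    using on(4) by (metis closed_segment_commute in_segment_dir)
  have c': "crossing ?T r s p q x" using c crossing_swap by blast
  have u0: "0 < u"
    using crossing_not_on_side[OF c, of "closed_segment B C"] ft u on by (cases "u = 0") auto
  have w0: "0 < w"
    using crossing_not_on_side[OF c, of "closed_segment A B"] ft w on by (cases "w = 0") auto
  have v0: "0 < v"
    using crossing_not_on_side[OF c', of "closed_segment C A"] ft v on by (cases "v = 0") auto
  have z0: "0 < z"
    using crossing_not_on_side[OF c', of "closed_segment A B"] ft z on by (cases "z = 0") auto
  obtain t t' where t: "0 < t" "t \<le> 1" "x = p + t *\<^sub>R (q - p)" and t': "0 < t'" "t' \<le> 1" "x = r + t' *\<^sub>R (s - r)"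
    using crossing_params[OF c] .
  have T: "convex hull {B, A, C} = ?T" by (simp add: insert_commute)
  have D': "side B A C = - ?D" by (simp add: side_coords algebra_simps)
  have D'0: "side B A C \<noteq> 0" using D D' by simp
  have pn: "p = A + (1 - u) *\<^sub>R (B - A)" by (simp add: u algebra_simps)
  have ne: "1 - u \<noteq> v"
  proof
    assume "1 - u = v"
    then have "p = r" by (simp add: pn v)
    then have "p \<in> closed_segment p q \<inter> closed_segment r s" by simp
    then show False using crossing_Int[OF c] crossing_distinct[OF c] by simp
  qed
  have xi: "x \<in> interior ?T" and orth: "(q - p) \<bullet> (s - r) = 0" using c by (simp_all add: crossing_def orthogonal_def)
  have inT: "p \<in> ?T" "r \<in> ?T" using frontier_triangle_subset[of A B C] c by (auto simp: crossing_def)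
  have \<eta>1: "side A B x = (t * w) * ?D"
    unfolding t(3) u(3) w(3) by (simp add: side_coords algebra_simps)
  have \<eta>2: "side A B x = (t' * z) * ?D"
    unfolding t'(3) v(3) z(3) by (simp add: side_coords algebra_simps)
  have \<xi>1: "side C A x = ((1 - t) * (1 - u) + t * (1 - w)) * ?D"
    unfolding t(3) u(3) w(3) by (simp add: side_coords algebra_simps)
  have \<xi>2: "side C A x = ((1 - t') * v) * ?D"
    unfolding t'(3) v(3) z(3) by (simp add: side_coords algebra_simps)
  have n1: "side B p q \<noteq> 0" and n2: "side A r s \<noteq> 0"
    using corner_triangle(1)[OF D'0 u0 u(2) w0 w(2) u(3) w(3)] corner_triangle(1)[OF D v0 v(2) z0 z(2) v(3) z(3)]
      D D' u0 w0 v0 z0 by simp_all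
  have n3: "side p r x \<noteq> 0" and n4: "- side p r x \<noteq> 0"
    using base_sector_triangle(2)[OF D xi pn v(3) ne inT t(1,3) t'(1,3)] by simp_all
  from e have "u * w = 1 / 2 \<and> v * z = 1 / 2 \<and> \<bar>v - (1 - u)\<bar> * \<bar>t * w\<bar> = 1 / 4"
    unfolding equal_quarters_iff[OF compact_triangle crossing_distinct(5,6)[OF c] n1 n2 n4 n3]
      half_area_iff[OF D v0 v(2) z0 z(2) v(3) z(3)]
      half_area_iff[OF D'0 u0 u(2) w0 w(2) u(3) w(3), unfolded T]
      quarter_area_iff[OF D xi pn v(3) ne inT t(1,3) t'(1,3) \<eta>1] .
  then have uw: "u * w = 1 / 2" and vz: "v * z = 1 / 2" and q: "\<bar>v - (1 - u)\<bar> * (t * w) = 1 / 4"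
    using t w0 by (simp_all add: abs_mult)
  have w': "w = 1 / (2 * u)" and z': "z = 1 / (2 * v)"
    using uw vz u0 v0 by (simp_all add: field_simps)
  have "1 / 2 \<le> u" "1 / 2 \<le> v"
    using mult_left_mono[OF w(2), of u] mult_left_mono[OF z(2), of v] u0 v0 unfolding uw vz by simp_all
  moreover from this ne have gt: "1 < u + v" by linarith
  have tt: "t * w = t' * z" using \<eta>1 \<eta>2 D by simp
  define \<eta>' where "\<eta>' = t * w"
  have tu: "t = 2 * u * \<eta>'" "t' = 2 * v * \<eta>'"
    using uw vz tt unfolding \<eta>'_def by algebra+
  have q': "(u + v - 1) * \<eta>' = 1 / 4" using q gt unfolding \<eta>'_def by (simp add: algebra_simps)
  have x2: "(1 - t) * (1 - u) + t * (1 - w) = (1 - t') * v" using \<xi>1 \<xi>2 D by simp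
  have "\<eta>' * (2 * u\<^sup>2 + 2 * v\<^sup>2 - 1) = u + v - 1"
    using x2 uw \<eta>'_def unfolding tu by algebra
  then have conic: "4 * (u + v - 1)\<^sup>2 = 2 * u\<^sup>2 + 2 * v\<^sup>2 - 1"
    using q' by algebra
  have "q - p = w *\<^sub>R ((2 * u\<^sup>2 - 1) *\<^sub>R (B - A) + (C - A))"
  proof -
    have "w * (2 * u\<^sup>2 - 1) = u - w" using uw by algebra
    then show ?thesis by (simp add: u w scaleR_add_right algebra_simps flip: scaleR_left_distrib)
  qed
  moreover have "s - r = z *\<^sub>R ((C - A) - (2 * v\<^sup>2) *\<^sub>R (B - A))"
  proof -
    have "z * (2 * v\<^sup>2) = v" using vz by algebra
    then show ?thesis by (simp add: v z scaleR_diff_right)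
  qed
  ultimately have "((2 * u\<^sup>2 - 1) *\<^sub>R (B - A) + (C - A)) \<bullet> ((C - A) - (2 * v\<^sup>2) *\<^sub>R (B - A)) = 0"
    using orth w0 z0 by simp
  then have "admissible A B C u v"
    unfolding admissible_def using \<open>1 / 2 \<le> u\<close> \<open>1 / 2 \<le> v\<close> u(2) v(2) gt conic by blast
  moreover have "{closed_segment p q, closed_segment r s} = cut_pair A B C u v"
    unfolding cut_pair_def w'[symmetric] z'[symmetric] u(3) v(3) w(3) z(3) ..
  ultimately show ?thesis by blast
qed

text \<open>If both chords cut off the corner \<open>A\<close>, they intersect at relative height
  \<open>1 / (2 (u + v))\<close>. The triangular region then has a quarter of the area only if one
  of \<open>u\<close>, \<open>v\<close> is three times the other, whereas half areas force both into
  \<open>[1/2, 1]\<close>.\<close>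
lemma quarters_not_same_corner:
  assumes D: "side A B C \<noteq> 0"
    and c: "crossing (convex hull {A, B, C}) p q r s x" and e: "equal_quarters (convex hull {A, B, C}) p q r s"
    and on: "p \<in> closed_segment A B" "q \<in> closed_segment C A" "r \<in> closed_segment A B" "s \<in> closed_segment C A"
  shows False
proof -
  let ?T = "convex hull {A, B, C}" and ?D = "side A B C"
  note ft = frontier_triangle[of A B C]
  obtain u where u: "0 \<le> u" "u \<le> 1" "p = A + u *\<^sub>R (B - A)" using on(1) by (auto simp: in_segment_dir)
  obtain w where w: "0 \<le> w" "w \<le> 1" "q = A + w *\<^sub>R (C - A)"
    using on(2) by (metis closed_segment_commute in_segment_dir)
  obtain v where v: "0 \<le> v" "v \<le> 1" "r = A + v *\<^sub>R (B - A)" using on(3) by (auto simp: in_segment_dir)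
  obtain z where z: "0 \<le> z" "z \<le> 1" "s = A + z *\<^sub>R (C - A)"
    using on(4) by (metis closed_segment_commute in_segment_dir)
  have c': "crossing ?T r s p q x" using c crossing_swap by blast
  have u0: "0 < u"
    using crossing_not_on_side[OF c, of "closed_segment C A"] ft u on by (cases "u = 0") auto
  have w0: "0 < w"
    using crossing_not_on_side[OF c, of "closed_segment A B"] ft w on by (cases "w = 0") auto
  have v0: "0 < v"
    using crossing_not_on_side[OF c', of "closed_segment C A"] ft v on by (cases "v = 0") auto
  have z0: "0 < z"
    using crossing_not_on_side[OF c', of "closed_segment A B"] ft z on by (cases "z = 0") auto
  obtain t t' where t: "0 < t" "t \<le> 1" "x = p + t *\<^sub>R (q - p)" and t': "0 < t'" "t' \<le> 1" "x = r + t' *\<^sub>R (s - r)"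
    using crossing_params[OF c] .
  have ne: "u \<noteq> v"
  proof
    assume "u = v"
    then have "p = r" by (simp add: u v)
    then have "p \<in> closed_segment p q \<inter> closed_segment r s" by simp
    then show False using crossing_Int[OF c] crossing_distinct[OF c] by simp
  qed
  have xi: "x \<in> interior ?T" using c by (simp add: crossing_def)
  have inT: "p \<in> ?T" "r \<in> ?T" using frontier_triangle_subset[of A B C] c by (auto simp: crossing_def)
  have \<eta>1: "side A B x = (t * w) * ?D"
    unfolding t(3) u(3) w(3) by (simp add: side_coords algebra_simps)
  have \<eta>2: "side A B x = (t' * z) * ?D"
    unfolding t'(3) v(3) z(3) by (simp add: side_coords algebra_simps)
  have \<xi>1: "side C A x = ((1 - t) * u) * ?D"
    unfolding t(3) u(3) w(3) by (simp add: side_coords algebra_simps)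
  have \<xi>2: "side C A x = ((1 - t') * v) * ?D"
    unfolding t'(3) v(3) z(3) by (simp add: side_coords algebra_simps)
  have n1: "side A p q \<noteq> 0" and n2: "side A r s \<noteq> 0"
    using corner_triangle(1)[OF D u0 u(2) w0 w(2) u(3) w(3)] corner_triangle(1)[OF D v0 v(2) z0 z(2) v(3) z(3)]
      D u0 w0 v0 z0 by simp_all
  have n3: "side p r x \<noteq> 0" and n4: "- side p r x \<noteq> 0"
    using base_sector_triangle(2)[OF D xi u(3) v(3) ne inT t(1,3) t'(1,3)] by simp_all
  from e have "u * w = 1 / 2 \<and> v * z = 1 / 2 \<and> \<bar>v - u\<bar> * \<bar>t * w\<bar> = 1 / 4"
    unfolding equal_quarters_iff[OF compact_triangle crossing_distinct(5,6)[OF c] n1 n2 n4 n3]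
      half_area_iff[OF D v0 v(2) z0 z(2) v(3) z(3)] half_area_iff[OF D u0 u(2) w0 w(2) u(3) w(3)]
      quarter_area_iff[OF D xi u(3) v(3) ne inT t(1,3) t'(1,3) \<eta>1] .
  then have uw: "u * w = 1 / 2" and vz: "v * z = 1 / 2" and q: "\<bar>v - u\<bar> * (t * w) = 1 / 4"
    using t w0 by (simp_all add: abs_mult)
  have uv: "1 / 2 \<le> u" "1 / 2 \<le> v"
    using mult_left_mono[OF w(2), of u] mult_left_mono[OF z(2), of v] u0 v0 unfolding uw vz by simp_all
  have tt: "t * w = t' * z" using \<eta>1 \<eta>2 D by simp
  define \<eta>' where "\<eta>' = t * w"
  have tu: "t = 2 * u * \<eta>'" "t' = 2 * v * \<eta>'"
    using uw vz tt unfolding \<eta>'_def by algebra+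
  have "(1 - t) * u = (1 - t') * v" using \<xi>1 \<xi>2 D by simp
  then have "(v - u) * (2 * (u + v) * \<eta>' - 1) = 0" unfolding tu by algebra
  then have h: "2 * (u + v) * \<eta>' = 1" using ne by simp
  from q have "\<bar>v - u\<bar> * \<eta>' = 1 / 4" by (simp add: \<eta>'_def)
  then have "(2 * \<bar>v - u\<bar>) * \<eta>' = (u + v) * \<eta>'" using h by algebra
  moreover have "\<eta>' \<noteq> 0" using h by auto
  ultimately have "2 * \<bar>v - u\<bar> = u + v" by simp
  then have "v = 3 * u \<or> u = 3 * v" by (auto simp: abs_if split: if_splits)
  then show False using uv u(2) v(2) by auto
qed

text \<open>On the conic, \<open>(u - v)\<^sup>2 = (3 (u + v) - 5) (u + v - 1)\<close>.\<close>
lemma admissible_sum_ge: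
  assumes "admissible A B C u v" shows "5 / 3 \<le> u + v" "2 / 3 \<le> u" "2 / 3 \<le> v"
proof -
  have a: "1 < u + v" "4 * (u + v - 1)\<^sup>2 = 2 * u\<^sup>2 + 2 * v\<^sup>2 - 1" "u \<le> 1" "v \<le> 1"
    using assms by (simp_all add: admissible_def)
  have "(u - v)\<^sup>2 = (3 * (u + v) - 5) * (u + v - 1)" using a(2) by algebra
  then have "0 \<le> (3 * (u + v) - 5) * (u + v - 1)" by (metis zero_le_power2)
  then show "5 / 3 \<le> u + v" using a(1) by (simp add: zero_le_mult_iff)
  then show "2 / 3 \<le> u" "2 / 3 \<le> v" using a by simp_all
qed

text \<open>The computation of \<open>quarters_base_adjacent\<close> read backwards. The bounds on
  \<open>u\<close> and \<open>v\<close> are needed to see that the chords do cross inside the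
  triangle.\<close>
lemma admissible_imp_quadrisection:
  assumes D: "side A B C \<noteq> 0" and adm: "admissible A B C u v"
  shows "quadrisection (convex hull {A, B, C}) (cut_pair A B C u v)"
proof -
  let ?T = "convex hull {A, B, C}" and ?D = "side A B C"
  note ft = frontier_triangle[of A B C]
  have u: "1 / 2 \<le> u" "u \<le> 1" and v: "1 / 2 \<le> v" "v \<le> 1" and gt: "1 < u + v"
    and conic: "4 * (u + v - 1)\<^sup>2 = 2 * u\<^sup>2 + 2 * v\<^sup>2 - 1"
    and orth: "((2 * u\<^sup>2 - 1) *\<^sub>R (B - A) + (C - A)) \<bullet> ((C - A) - (2 * v\<^sup>2) *\<^sub>R (B - A)) = 0"
    using adm by (simp_all add: admissible_def)
  define w where "w = 1 / (2 * u)"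
  define z where "z = 1 / (2 * v)"
  define \<eta> where "\<eta> = 1 / (4 * (u + v - 1))"
  define t where "t = 2 * u * \<eta>"
  define t' where "t' = 2 * v * \<eta>"
  define p where "p = B + u *\<^sub>R (A - B)"
  define q where "q = B + w *\<^sub>R (C - B)"
  define r where "r = A + v *\<^sub>R (B - A)"
  define s where "s = A + z *\<^sub>R (C - A)"
  define x where "x = p + t *\<^sub>R (q - p)"
  have uw: "u * w = 1 / 2" and vz: "v * z = 1 / 2" using u v by (simp_all add: w_def z_def)
  have u0: "0 < u" and v0: "0 < v" using u v by simp_all
  have w01: "0 < w" "w \<le> 1" and z01: "0 < z" "z \<le> 1" using u v by (simp_all add: w_def z_def)
  have h: "4 * (u + v - 1) * \<eta> = 1" and \<eta>0: "0 < \<eta>" using gt by (simp_all add: \<eta>_def)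
  note ge = admissible_sum_ge[OF adm]
  have tu: "0 < t" "t < 1" and tv: "0 < t'" "t' < 1"
    using gt ge u v u0 v0 by (simp_all add: t_def t'_def \<eta>_def)
  have pn: "p = A + (1 - u) *\<^sub>R (B - A)" by (simp add: p_def algebra_simps)
  have tw: "t * w = \<eta>" using uw unfolding t_def by algebra
  have tz: "t' * z = \<eta>" using vz unfolding t'_def by algebra
  have k: "\<eta> * (2 * u\<^sup>2 + 2 * v\<^sup>2 - 1) = u + v - 1" using h conic by algebra
  have "(1 - u) + t * u - \<eta> = v - t' * v"
    using k unfolding t_def t'_def by algebra
  moreover have "x = A + ((1 - u) + t * u - t * w) *\<^sub>R (B - A) + (t * w) *\<^sub>R (C - A)"
    by (simp add: x_def p_def q_def algebra_simps)
  moreover have "r + t' *\<^sub>R (s - r) = A + (v - t' * v) *\<^sub>R (B - A) + (t' * z) *\<^sub>R (C - A)"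
    by (simp add: r_def s_def algebra_simps)
  ultimately have x': "x = r + t' *\<^sub>R (s - r)"
    and xc: "x = A + (v - t' * v) *\<^sub>R (B - A) + \<eta> *\<^sub>R (C - A)" by (simp_all add: tw tz)
  have bar: "(u - t * u) + (v - t' * v) + \<eta> = 1"
    using k unfolding t_def t'_def by algebra
  have "x = (u - t * u) *\<^sub>R A + (v - t' * v) *\<^sub>R B + \<eta> *\<^sub>R C"
  proof -
    have "A + b *\<^sub>R (B - A) + c *\<^sub>R (C - A) = a *\<^sub>R A + b *\<^sub>R B + c *\<^sub>R C"
      if "a + b + c = 1" for a b c :: real
    proof -
      have a: "a = 1 - b - c" using that by simp
      show ?thesis unfolding a by (simp add: algebra_simps)
    qed
    then show ?thesis unfolding xc using bar by blast
  qed
  moreover have "0 < u - t * u" "0 < v - t' * v" using tu tv u0 v0 by simp_all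
  ultimately have xi: "x \<in> interior ?T"
    using \<eta>0 bar D
    by (subst interior_convex_hull_3_minimal, simp add: collinear_iff_side, simp, unfold mem_Collect_eq,
        intro exI[of _ "u - t * u"] exI[of _ "v - t' * v"] exI[of _ \<eta>] conjI) simp_all
  have on: "p \<in> closed_segment A B" "q \<in> closed_segment B C" "r \<in> closed_segment A B" "s \<in> closed_segment C A"
  proof -
    have *: "X + k *\<^sub>R (Y - X) \<in> closed_segment X Y" if "0 \<le> k" "k \<le> 1" for k and X Y :: "real^2"
      using that in_segment_dir by blast
    show "p \<in> closed_segment A B" "r \<in> closed_segment A B" unfolding pn r_def using u v by (auto intro: *)
    show "q \<in> closed_segment B C" unfolding q_def using w01 by (auto intro: *)
    show "s \<in> closed_segment C A"
      unfolding s_def closed_segment_commute[of C A] using z01 by (auto intro: *)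
  qed
  have "q - p = w *\<^sub>R ((2 * u\<^sup>2 - 1) *\<^sub>R (B - A) + (C - A))"
  proof -
    have "w * (2 * u\<^sup>2 - 1) = u - w" using uw by algebra
    then show ?thesis by (simp add: p_def q_def scaleR_add_right algebra_simps flip: scaleR_left_distrib)
  qed
  moreover have "s - r = z *\<^sub>R ((C - A) - (2 * v\<^sup>2) *\<^sub>R (B - A))"
  proof -
    have "z * (2 * v\<^sup>2) = v" using vz by algebra
    then show ?thesis by (simp add: r_def s_def scaleR_diff_right)
  qed
  ultimately have orth': "orthogonal (q - p) (s - r)" using orth by (simp add: orthogonal_def)
  have c: "crossing ?T p q r s x"
  proof -
    have "x \<in> closed_segment p q" unfolding in_segment_dir using x_def tu by (intro exI[of _ t]) simp
    moreover have "x \<in> closed_segment r s" unfolding in_segment_dir using x' tv by (intro exI[of _ t']) simp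
    ultimately show ?thesis using ft on xi orth' by (simp add: crossing_def)
  qed
  have T: "convex hull {B, A, C} = ?T" by (simp add: insert_commute)
  have D': "side B A C = - ?D" by (simp add: side_coords algebra_simps)
  have D'0: "side B A C \<noteq> 0" using D D' by simp
  have ne: "1 - u \<noteq> v" using gt by simp
  have inT: "p \<in> ?T" "r \<in> ?T" using frontier_triangle_subset[of A B C] c by (auto simp: crossing_def)
  have \<eta>: "side A B x = \<eta> * ?D"
    unfolding xc by (simp add: side_coords algebra_simps)
  have n1: "side B p q \<noteq> 0" and n2: "side A r s \<noteq> 0"
    using corner_triangle(1)[OF D'0 u0 u(2) w01 p_def q_def] corner_triangle(1)[OF D v0 v(2) z01 r_def s_def]
      D D' u0 w01 v0 z01 by simp_all
  have n3: "side p r x \<noteq> 0" and n4: "- side p r x \<noteq> 0"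
    using base_sector_triangle(2)[OF D xi pn r_def ne inT tu(1) x_def tv(1) x'] by simp_all
  have "equal_quarters ?T p q r s"
    unfolding equal_quarters_iff[OF compact_triangle crossing_distinct(5,6)[OF c] n1 n2 n4 n3]
      half_area_iff[OF D v0 v(2) z01 r_def s_def]
      half_area_iff[OF D'0 u0 u(2) w01 p_def q_def, unfolded T]
      quarter_area_iff[OF D xi pn r_def ne inT tu(1) x_def tv(1) x' \<eta>]
    using uw vz gt \<eta>0 h by (simp add: algebra_simps)
  moreover have "cut_pair A B C u v = {closed_segment p q, closed_segment r s}"
    by (simp add: cut_pair_def p_def q_def r_def s_def w_def z_def)
  ultimately show ?thesis
    unfolding quadrisection_iff_equal_quarters[OF compact_triangle convex_convex_hull] using c
    by - (intro exI conjI, assumption+)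
qed

lemma equal_quarters_swap:
  "equal_quarters T p q r s \<longleftrightarrow> equal_quarters T r s p q"
  "equal_quarters T p q r s \<longleftrightarrow> equal_quarters T q p r s"
proof -
  have 1: "sector T g f a b = sector T f g b a" for f g a b by (auto simp: sector_def)
  show "equal_quarters T p q r s \<longleftrightarrow> equal_quarters T r s p q"
    unfolding equal_quarters_def Let_def 1[of "side r s" "side p q"] by (simp add: insert_commute)
  have "side q p z = - side p q z" for z by (simp add: side_coords algebra_simps)
  then have 2: "sector T (side q p) g a b = sector T (side p q) g (- a) b" for g a b
    by (simp add: sector_def)
  show "equal_quarters T p q r s \<longleftrightarrow> equal_quarters T q p r s"
    unfolding equal_quarters_def Let_def 2 by (simp add: insert_commute)
qed

lemma quarters_sharing_side:
  assumes D: "side A B C \<noteq> 0"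
    and c: "crossing (convex hull {A, B, C}) p q r s x" and e: "equal_quarters (convex hull {A, B, C}) p q r s"
    and on: "p \<in> closed_segment A B" "r \<in> closed_segment A B"
  shows "\<exists>u v. admissible A B C u v \<and> {closed_segment p q, closed_segment r s} = cut_pair A B C u v"
proof -
  note ft = frontier_triangle[of A B C]
  have c': "crossing (convex hull {A, B, C}) r s p q x" and e': "equal_quarters (convex hull {A, B, C}) r s p q"
    using c e crossing_swap equal_quarters_swap by blast+
  have "q \<notin> closed_segment A B" "s \<notin> closed_segment A B"
    using crossing_not_on_side[OF c convex_closed_segment[of A B]] crossing_not_on_side[OF c' convex_closed_segment[of A B]] ft on by auto
  moreover have "q \<in> frontier (convex hull {A, B, C})" "s \<in> frontier (convex hull {A, B, C})"
    using c by (simp_all add: crossing_def)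
  ultimately have q: "q \<in> closed_segment B C \<or> q \<in> closed_segment C A"
    and s: "s \<in> closed_segment B C \<or> s \<in> closed_segment C A"
    unfolding ft by auto
  have D': "side B A C \<noteq> 0" using D by (simp add: side_coords algebra_simps)
  have T: "convex hull {B, A, C} = convex hull {A, B, C}" by (simp add: insert_commute)
  consider "q \<in> closed_segment B C" "s \<in> closed_segment C A" | "q \<in> closed_segment C A" "s \<in> closed_segment B C"
    | "q \<in> closed_segment C A" "s \<in> closed_segment C A" | "q \<in> closed_segment B C" "s \<in> closed_segment B C"
    using q s by blast
  then show ?thesis
  proof cases
    case 1 then show ?thesis using quarters_base_adjacent[OF D c e] on by blast
  next
    case 2 then show ?thesis using quarters_base_adjacent[OF D c' e'] on by (metis insert_commute)
  next
    case 3 then show ?thesis using quarters_not_same_corner[OF D c e] on by blast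
  next
    case 4 then show ?thesis using quarters_not_same_corner[OF D', unfolded T, OF c e] on
      by (metis closed_segment_commute)
  qed
qed

text \<open>Up to reversing the chords, their ends on \<open>A B\<close> are \<open>p\<close> and
  \<open>r\<close>.\<close>
lemma quarters_touching_side:
  assumes D: "side A B C \<noteq> 0"
    and c: "crossing (convex hull {A, B, C}) p q r s x" and e: "equal_quarters (convex hull {A, B, C}) p q r s"
    and on: "p \<in> closed_segment A B \<or> q \<in> closed_segment A B" "r \<in> closed_segment A B \<or> s \<in> closed_segment A B"
  shows "\<exists>u v. admissible A B C u v \<and> {closed_segment p q, closed_segment r s} = cut_pair A B C u v"
proof -
  let ?T = "convex hull {A, B, C}"
  have turn: "\<exists>p' q'. p' \<in> closed_segment A B \<and> crossing ?T p' q' r s x \<and> equal_quarters ?T p' q' r s \<and>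
      closed_segment p' q' = closed_segment p q"
    if "crossing ?T p q r s x" "equal_quarters ?T p q r s" "p \<in> closed_segment A B \<or> q \<in> closed_segment A B"
    for p q r s
    using that(3)
  proof
    assume "p \<in> closed_segment A B"
    then show ?thesis using that by blast
  next
    assume q: "q \<in> closed_segment A B"
    have "crossing ?T q p r s x" using that(1) crossing_swap(2) by blast
    moreover have "equal_quarters ?T q p r s" using that(2) equal_quarters_swap(2) by blast
    ultimately show ?thesis using q closed_segment_commute by blast
  qed
  obtain p' q' where p': "p' \<in> closed_segment A B" "crossing ?T p' q' r s x" "equal_quarters ?T p' q' r s"
      "closed_segment p' q' = closed_segment p q"
    using turn[OF c e on(1)] by blast
  have "crossing ?T r s p' q' x" "equal_quarters ?T r s p' q'"
    using p' crossing_swap(1) equal_quarters_swap(1) by blast+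
  then obtain r' s' where r': "r' \<in> closed_segment A B" "crossing ?T r' s' p' q' x" "equal_quarters ?T r' s' p' q'"
      "closed_segment r' s' = closed_segment r s"
    using turn[of r s p' q'] on(2) by blast
  show ?thesis
    using quarters_sharing_side[OF D r'(2,3,1) p'(1)] unfolding p'(4) r'(4) by (metis insert_commute)
qed

text \<open>Each chord has ends on two of the three sides, so the two chords have a side in
  common.\<close>
proposition quadrisection_triangle_iff:
  assumes D: "side A B C \<noteq> 0"
  shows "quadrisection (convex hull {A, B, C}) Q \<longleftrightarrow>
    (\<exists>u v. admissible A B C u v \<and> Q = cut_pair A B C u v \<or>
           admissible B C A u v \<and> Q = cut_pair B C A u v \<or>
           admissible C A B u v \<and> Q = cut_pair C A B u v)" (is "_ \<longleftrightarrow> ?R")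
proof
  have D1: "side B C A \<noteq> 0" and D2: "side C A B \<noteq> 0" using D by (simp_all add: side_cyclic)
  have T1: "convex hull {B, C, A} = convex hull {A, B, C}" and T2: "convex hull {C, A, B} = convex hull {A, B, C}"
    by (simp_all add: insert_commute)
  {
    assume "quadrisection (convex hull {A, B, C}) Q"
    then obtain p q r s x where Q: "Q = {closed_segment p q, closed_segment r s}"
      and c: "crossing (convex hull {A, B, C}) p q r s x" and e: "equal_quarters (convex hull {A, B, C}) p q r s"
      unfolding quadrisection_iff_equal_quarters[OF compact_triangle convex_convex_hull] by (elim exE conjE)
    have c': "crossing (convex hull {A, B, C}) r s p q x" using c crossing_swap by blast
    note ft = frontier_triangle[of A B C]
    have "\<not> (p \<in> S \<and> q \<in> S)" "\<not> (r \<in> S \<and> s \<in> S)"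
      if "S = closed_segment A B \<or> S = closed_segment B C \<or> S = closed_segment C A" for S
      using crossing_not_on_side[OF c, of S] crossing_not_on_side[OF c', of S] that unfolding ft by auto
    moreover have "y \<in> closed_segment A B \<or> y \<in> closed_segment B C \<or> y \<in> closed_segment C A"
      if "y \<in> {p, q, r, s}" for y
      using c that ft unfolding crossing_def by blast
    ultimately have "(p \<in> closed_segment A B \<or> q \<in> closed_segment A B) \<and> (r \<in> closed_segment A B \<or> s \<in> closed_segment A B) \<or>
       (p \<in> closed_segment B C \<or> q \<in> closed_segment B C) \<and> (r \<in> closed_segment B C \<or> s \<in> closed_segment B C) \<or>
       (p \<in> closed_segment C A \<or> q \<in> closed_segment C A) \<and> (r \<in> closed_segment C A \<or> s \<in> closed_segment C A)"
      by (metis insertCI)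
    then show ?R
      using quarters_touching_side[OF D c e] quarters_touching_side[OF D1, unfolded T1, OF c e]
        quarters_touching_side[OF D2, unfolded T2, OF c e] unfolding Q by blast
  }
  assume ?R
  then show "quadrisection (convex hull {A, B, C}) Q"
    using admissible_imp_quadrisection[OF D] admissible_imp_quadrisection[OF D1, unfolded T1]
      admissible_imp_quadrisection[OF D2, unfolded T2] by blast
qed

section \<open>Isosceles triangles with exactly two quadrisections\<close>

lemma cut_pair_swap: "cut_pair A B C u v = cut_pair B A C v u"
  by (simp add: cut_pair_def insert_commute)

text \<open>Perpendicularity in terms of the side lengths alone. Hence admissibility is invariant
  under relabelling vertices whenever the lengths agree.\<close>
lemma admissible_dist:
  "admissible A B C u v \<longleftrightarrow> 1/2 \<le> u \<and> u \<le> 1 \<and> 1/2 \<le> v \<and> v \<le> 1 \<and> 1 < u + v \<and>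
     4 * (u + v - 1)\<^sup>2 = 2 * u\<^sup>2 + 2 * v\<^sup>2 - 1 \<and>
     (dist A C)\<^sup>2 + (2 * u\<^sup>2 - 1 - 2 * v\<^sup>2) * ((dist A B)\<^sup>2 + (dist A C)\<^sup>2 - (dist B C)\<^sup>2) / 2
       = 2 * v\<^sup>2 * (2 * u\<^sup>2 - 1) * (dist A B)\<^sup>2"
proof -
  define b where "b = B - A"
  define e where "e = C - A"
  have "(dist A B)\<^sup>2 = b \<bullet> b" "(dist A C)\<^sup>2 = e \<bullet> e"
    unfolding b_def e_def power2_norm_eq_inner[symmetric] by (simp_all add: dist_norm norm_minus_commute)
  moreover have "(dist B C)\<^sup>2 = (b - e) \<bullet> (b - e)"
    by (simp add: b_def e_def dist_norm power2_norm_eq_inner)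
  ultimately have "((2 * u\<^sup>2 - 1) *\<^sub>R b + e) \<bullet> (e - (2 * v\<^sup>2) *\<^sub>R b) = 0 \<longleftrightarrow>
     (dist A C)\<^sup>2 + (2 * u\<^sup>2 - 1 - 2 * v\<^sup>2) * ((dist A B)\<^sup>2 + (dist A C)\<^sup>2 - (dist B C)\<^sup>2) / 2
       = 2 * v\<^sup>2 * (2 * u\<^sup>2 - 1) * (dist A B)\<^sup>2"
    by (simp add: inner_add_left inner_add_right inner_diff_left inner_diff_right inner_commute[of e b])
       (simp add: algebra_simps)
  then show ?thesis
    unfolding admissible_def b_def[symmetric] e_def[symmetric] by simp
qed

lemma admissible_swap: "admissible A B C u v \<longleftrightarrow> admissible B A C v u"
proof -
  have "Y + (2 * u\<^sup>2 - 1 - 2 * v\<^sup>2) * (X + Y - Z) / 2 - 2 * v\<^sup>2 * (2 * u\<^sup>2 - 1) * X =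
      Z + (2 * v\<^sup>2 - 1 - 2 * u\<^sup>2) * (X + Z - Y) / 2 - 2 * u\<^sup>2 * (2 * v\<^sup>2 - 1) * X" for X Y Z :: real
    by (simp add: field_simps)
  then have "Y + (2 * u\<^sup>2 - 1 - 2 * v\<^sup>2) * (X + Y - Z) / 2 = 2 * v\<^sup>2 * (2 * u\<^sup>2 - 1) * X \<longleftrightarrow>
      Z + (2 * v\<^sup>2 - 1 - 2 * u\<^sup>2) * (X + Z - Y) / 2 = 2 * u\<^sup>2 * (2 * v\<^sup>2 - 1) * X" for X Y Z :: real
    by (metis right_minus_eq)
  note orth = this[where X = "(dist A B)\<^sup>2" and Y = "(dist A C)\<^sup>2" and Z = "(dist B C)\<^sup>2"]
  show ?thesis
    unfolding admissible_dist dist_commute[of B A] orth add.commute[of v u]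
      add.commute[of "2 * v\<^sup>2" "2 * u\<^sup>2"] by blast
qed

definition affine_pt :: "real^2 \<Rightarrow> real^2 \<Rightarrow> real^2 \<Rightarrow> real \<Rightarrow> real \<Rightarrow> real^2" where
  "affine_pt a b c k l = a + k *\<^sub>R (b - a) + l *\<^sub>R (c - a)"

lemma side_affine_pt: "side c a (affine_pt a b c k l) = k * side a b c" "side a b (affine_pt a b c k l) = l * side a b c"
  by (simp_all add: affine_pt_def side_coords algebra_simps)

lemma affine_pt_eq_iff: "side a b c \<noteq> 0 \<Longrightarrow> affine_pt a b c k l = affine_pt a b c k' l' \<longleftrightarrow> k = k' \<and> l = l'"
  by (metis side_affine_pt mult_cancel_right)

lemma affine_pt_coords:
  assumes "side a b c \<noteq> 0"
  shows "z = affine_pt a b c (side c a z / side a b c) (side a b z / side a b c)"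
proof -
  have "side a b c *\<^sub>R (z - a) = side c a z *\<^sub>R (b - a) + side a b z *\<^sub>R (c - a)"
    by (simp add: vec_eq_iff forall_2 side_coords algebra_simps)
  then have "(1 / side a b c) *\<^sub>R side a b c *\<^sub>R (z - a) =
      (1 / side a b c) *\<^sub>R (side c a z *\<^sub>R (b - a) + side a b z *\<^sub>R (c - a))" by simp
  then have "z - a = (side c a z / side a b c) *\<^sub>R (b - a) + (side a b z / side a b c) *\<^sub>R (c - a)"
    using assms by (simp add: scaleR_add_right)
  then show ?thesis by (simp add: affine_pt_def algebra_simps)
qed

text \<open>The affine map that fixes \<open>a\<close> and exchanges \<open>b\<close> and
  \<open>c\<close>. In an isosceles triangle with apex \<open>a\<close> this is the reflection in
  the axis; describing it by affine coordinates makes its action on cuts immediate.\<close>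
definition vertex_swap :: "real^2 \<Rightarrow> real^2 \<Rightarrow> real^2 \<Rightarrow> real^2 \<Rightarrow> real^2" where
  "vertex_swap a b c z = affine_pt a b c (side a b z / side a b c) (side c a z / side a b c)"

lemma vertex_swap_affine_pt: "side a b c \<noteq> 0 \<Longrightarrow> vertex_swap a b c (affine_pt a b c k l) = affine_pt a b c l k"
  by (simp add: vertex_swap_def side_affine_pt)

lemma vertex_swap_swap: "vertex_swap a c b = vertex_swap a b c"
proof
  fix z
  have "side a c b = - side a b c" "side a c z = - side c a z" "side b a z = - side a b z"
    by (simp_all add: side_coords algebra_simps)
  then show "vertex_swap a c b z = vertex_swap a b c z" by (simp add: vertex_swap_def affine_pt_def)
qed

lemma vertex_swap_involution: "side a b c \<noteq> 0 \<Longrightarrow> vertex_swap a b c (vertex_swap a b c z) = z"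
  using affine_pt_coords[of a b c z] vertex_swap_affine_pt by metis

lemma vertex_swap_affine:
  "vertex_swap a b c ((1 - t) *\<^sub>R x + t *\<^sub>R y) = (1 - t) *\<^sub>R vertex_swap a b c x + t *\<^sub>R vertex_swap a b c y"
proof -
  have "affine_pt a b c ((1 - t) * k + t * k') ((1 - t) * l + t * l') =
      (1 - t) *\<^sub>R affine_pt a b c k l + t *\<^sub>R affine_pt a b c k' l'" for k l k' l'
    by (simp add: affine_pt_def algebra_simps)
  then show ?thesis
    unfolding vertex_swap_def side_affine by (simp only: add_divide_distrib times_divide_eq_right[symmetric])
qed

lemma image_segment_affine:
  assumes "\<And>x y t. f ((1 - t) *\<^sub>R x + t *\<^sub>R y) = (1 - t) *\<^sub>R f x + t *\<^sub>R f y"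
  shows "f ` closed_segment x y = closed_segment (f x) (f y)"
  by (force simp: closed_segment_def assms)

lemma image_cut_pair:
  assumes f: "\<And>x y t. f ((1 - t) *\<^sub>R x + t *\<^sub>R y) = (1 - t) *\<^sub>R f x + t *\<^sub>R f y"
  shows "(`) f ` cut_pair A B C u v = cut_pair (f A) (f B) (f C) u v"
proof -
  have "X + k *\<^sub>R (Y - X) = (1 - k) *\<^sub>R X + k *\<^sub>R Y" for k and X Y :: "real^2"
    by (simp add: algebra_simps)
  then show ?thesis by (simp add: cut_pair_def image_segment_affine[OF f] f)
qed

lemma vertex_swap_vertices:
  assumes "side a b c \<noteq> 0"
  shows "vertex_swap a b c a = a" "vertex_swap a b c b = c" "vertex_swap a b c c = b"
  using vertex_swap_affine_pt[OF assms, of 0 0] vertex_swap_affine_pt[OF assms, of 1 0] vertex_swap_affine_pt[OF assms, of 0 1]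
  by (simp_all add: affine_pt_def)

lemma conic_half:
  assumes "admissible A B C u v" shows "u \<noteq> 1 / 2" "v \<noteq> 1 / 2"
  using admissible_sum_ge[OF assms] by auto

lemma base_cut_coords: "cut_pair b c a u v = {closed_segment (affine_pt a b c u (1 - u)) (affine_pt a b c 0 (1 - 1 / (2 * u))),
      closed_segment (affine_pt a b c (1 - v) v) (affine_pt a b c (1 - 1 / (2 * v)) 0)}"
  by (simp add: cut_pair_def affine_pt_def algebra_simps)

lemma leg_cut_coords: "cut_pair a b c u v = {closed_segment (affine_pt a b c (1 - u) 0) (affine_pt a b c (1 - 1 / (2 * u)) (1 / (2 * u))),
      closed_segment (affine_pt a b c v 0) (affine_pt a b c 0 (1 / (2 * v)))}"
  by (simp add: cut_pair_def affine_pt_def algebra_simps)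

text \<open>The reflection either exchanges the two chords, so that \<open>u = v\<close>, or maps
  the first chord to itself, so that this chord is the median. The latter is excluded by
  \<open>conic_half\<close>.\<close>
lemma invariant_base_cut:
  assumes D: "side a b c \<noteq> 0" and adm: "admissible b c a u v"
    and inv: "(`) (vertex_swap a b c) ` cut_pair b c a u v = cut_pair b c a u v"
  shows "u = 5 / 6 \<and> v = 5 / 6"
proof -
  have "closed_segment (affine_pt a b c (1 - u) u) (affine_pt a b c (1 - 1 / (2 * u)) 0) \<in> (`) (vertex_swap a b c) ` cut_pair b c a u v"
    unfolding base_cut_coords by (simp add: image_segment_affine[OF vertex_swap_affine] vertex_swap_affine_pt[OF D])
  then have "u = 1 / 2 \<or> u = v \<or> u = 0"
    unfolding inv unfolding base_cut_coords by (auto simp: doubleton_eq_iff affine_pt_eq_iff[OF D])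
  moreover have "0 < u" using adm by (simp add: admissible_def)
  ultimately have "u = v" using conic_half[OF adm] by auto
  moreover have "4 * (u + v - 1)\<^sup>2 = 2 * u\<^sup>2 + 2 * v\<^sup>2 - 1" using adm by (simp add: admissible_def)
  ultimately have "4 * (u + u - 1)\<^sup>2 = 2 * u\<^sup>2 + 2 * u\<^sup>2 - 1" by simp
  then have "(6 * u - 5) * (2 * u - 1) = 0" by algebra
  then show ?thesis using \<open>u = v\<close> conic_half[OF adm] by auto
qed

lemma conic_end:
  assumes "admissible A B C 1 v" shows "v = 1 / sqrt 2"
proof -
  have "4 * v\<^sup>2 = 2 * 1 + 2 * v\<^sup>2 - 1" "0 \<le> v" using assms by (simp_all add: admissible_def)
  then have "v\<^sup>2 = 1 / 2" by simp
  then show ?thesis using \<open>0 \<le> v\<close> by (metis real_sqrt_divide real_sqrt_one real_sqrt_unique)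
qed

text \<open>The first chord has an end on the leg \<open>a b\<close> and one on the base. Its mirror
  image joins the other leg to the base. It is the first chord itself only if that chord starts at
  the apex, and the second chord, which joins the two legs, only if its end on the base is a vertex;
  then \<open>u = 1/2\<close>, which \<open>conic_half\<close> excludes.\<close>
lemma invariant_leg_cut:
  assumes D: "side a b c \<noteq> 0" and adm: "admissible a b c u v"
    and inv: "(`) (vertex_swap a b c) ` cut_pair a b c u v = cut_pair a b c u v"
  shows "u = 1"
proof -
  have "closed_segment (affine_pt a b c 0 (1 - u)) (affine_pt a b c (1 / (2 * u)) (1 - 1 / (2 * u))) \<in> (`) (vertex_swap a b c) ` cut_pair a b c u v"
    unfolding leg_cut_coords by (simp add: image_segment_affine[OF vertex_swap_affine] vertex_swap_affine_pt[OF D])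
  moreover have "0 < u" "0 < v" using adm by (simp_all add: admissible_def)
  ultimately have "u = 1 \<or> u = 1 / 2"
    unfolding inv unfolding leg_cut_coords by (auto simp: doubleton_eq_iff affine_pt_eq_iff[OF D])
  then show ?thesis using conic_half[OF adm] by auto
qed

text \<open>The axis through \<open>a\<close> and the parallel to the base that halves the area,
  seen as a cut on the leg \<open>a b\<close> at the end \<open>u = 1\<close> of the conic. By
  \<open>axis_cut_swap\<close> it is also a cut on the other leg.\<close>
abbreviation axis_cut :: "real^2 \<Rightarrow> real^2 \<Rightarrow> real^2 \<Rightarrow> (real^2) set set" where
  "axis_cut a b c \<equiv> cut_pair a b c 1 (1 / sqrt 2)"

lemma axis_cut_admissible:
  assumes "dist a b = dist a c" shows "admissible a b c 1 (1 / sqrt 2)"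
proof -
  define v :: real where "v = 1 / sqrt 2"
  have v2: "v\<^sup>2 = 1 / 2" by (simp add: v_def power_divide)
  have "1 / 2 \<le> v" "v \<le> 1"
    by (simp_all add: v_def divide_simps real_le_lsqrt)
  then have "admissible a b c 1 v" unfolding admissible_dist by (simp add: v2 assms)
  then show ?thesis by (simp add: v_def)
qed

lemma axis_cut_swap: "axis_cut a c b = axis_cut a b c"
proof -
  have "1 / (2 * (1 / sqrt 2)) = 1 / sqrt 2" by (simp add: field_simps)
  moreover have "c + (1/2) *\<^sub>R (b - c) = b + (1/2) *\<^sub>R (c - b)"
    by (simp add: vec_eq_iff field_simps)
  ultimately show ?thesis by (simp add: cut_pair_def closed_segment_commute)
qed

text \<open>The reflection permutes the two quadrisections and fixes the axis cut, so it fixes the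
  other one. An invariant cut on a leg is the axis cut, so the other one is an invariant cut on the
  base.\<close>
lemma isosceles_two_quadrisections:
  assumes D: "side a b c \<noteq> 0" and iso: "dist a b = dist a c"
    and card: "card {Q. quadrisection (convex hull {a, b, c}) Q} = 2"
  shows "admissible b c a (5 / 6) (5 / 6)"
proof -
  let ?q = "quadrisection (convex hull {a, b, c})" and ?\<rho> = "vertex_swap a b c"
  note iff = quadrisection_triangle_iff[OF D]
  have Q0: "?q (axis_cut a b c)" using axis_cut_admissible[OF iso] iff by blast
  from card obtain X Y where XY: "{Q. ?q Q} = {X, Y}" "X \<noteq> Y" by (auto simp: card_2_iff)
  obtain Q1 where Q1: "?q Q1" "Q1 \<noteq> axis_cut a b c"
    using XY by (metis insertCI mem_Collect_eq)
  have two: "Q = axis_cut a b c \<or> Q = Q1" if "?q Q" for Q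
  proof -
    have "Q \<in> {X, Y}" "axis_cut a b c \<in> {X, Y}" "Q1 \<in> {X, Y}" using that Q0 Q1 XY(1) by blast+
    then show ?thesis using Q1(2) by auto
  qed
  have image: "(`) ?\<rho> ` cut_pair A B C u v = cut_pair (?\<rho> A) (?\<rho> B) (?\<rho> C) u v" for A B C u v
    by (rule image_cut_pair) (rule vertex_swap_affine)
  note vert = vertex_swap_vertices[OF D]
  have adm_base: "admissible c b a u v \<longleftrightarrow> admissible b c a u v" for u v
    unfolding admissible_dist using iso by (simp add: dist_commute)
  have adm_leg: "admissible a c b u v \<longleftrightarrow> admissible a b c u v" for u v
    unfolding admissible_dist using iso by (simp add: dist_commute)
  have "?q ((`) ?\<rho> ` Q)" if "?q Q" for Q
  proof -
    from that obtain u v where "admissible a b c u v \<and> Q = cut_pair a b c u v \<or>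
        admissible b c a u v \<and> Q = cut_pair b c a u v \<or> admissible c a b u v \<and> Q = cut_pair c a b u v"
      unfolding iff by blast
    then show ?thesis
    proof (elim disjE conjE)
      assume "admissible a b c u v" "Q = cut_pair a b c u v"
      then have "admissible c a b v u" "(`) ?\<rho> ` Q = cut_pair c a b v u"
        using adm_leg[of u v] admissible_swap[of c a b v u] cut_pair_swap[of c a b v u]
        by (simp_all only: image vert)
      then show ?thesis unfolding iff by blast
    next
      assume "admissible b c a u v" "Q = cut_pair b c a u v"
      then have "admissible b c a v u" "(`) ?\<rho> ` Q = cut_pair b c a v u"
        using adm_base[of v u] admissible_swap[of b c a u v] cut_pair_swap[of c b a u v]
        by (simp_all only: image vert)
      then show ?thesis unfolding iff by blast
    next
      assume "admissible c a b u v" "Q = cut_pair c a b u v"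
      then have "admissible a b c v u" "(`) ?\<rho> ` Q = cut_pair a b c v u"
        using adm_leg[of v u] admissible_swap[of c a b u v] cut_pair_swap[of b a c u v]
        by (simp_all only: image vert)
      then show ?thesis unfolding iff by blast
    qed
  qed
  moreover have fix0: "(`) ?\<rho> ` axis_cut a b c = axis_cut a b c"
    unfolding image vert by (rule axis_cut_swap)
  moreover have inv2: "(`) ?\<rho> ` (`) ?\<rho> ` Q = Q" for Q
    by (simp add: image_image vertex_swap_involution[OF D])
  ultimately have fix1: "(`) ?\<rho> ` Q1 = Q1"
    using two Q1 by metis
  from Q1(1) obtain u v where "admissible a b c u v \<and> Q1 = cut_pair a b c u v \<or>
      admissible b c a u v \<and> Q1 = cut_pair b c a u v \<or> admissible c a b u v \<and> Q1 = cut_pair c a b u v"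
    unfolding iff by blast
  then show ?thesis
  proof (elim disjE conjE)
    assume "admissible a b c u v" "Q1 = cut_pair a b c u v"
    then show ?thesis using invariant_leg_cut[OF D] conic_end fix1 Q1(2) by metis
  next
    assume "admissible b c a u v" "Q1 = cut_pair b c a u v"
    then show ?thesis using invariant_base_cut[OF D] fix1 by metis
  next
    assume "admissible c a b u v" "Q1 = cut_pair c a b u v"
    then have Q: "admissible a c b v u" "Q1 = cut_pair a c b v u"
      using admissible_swap[of c a b] cut_pair_swap[of c a b] by auto
    have D': "side a c b \<noteq> 0" using D by (simp add: side_coords algebra_simps)
    have "(`) (vertex_swap a c b) ` cut_pair a c b v u = cut_pair a c b v u"
      unfolding vertex_swap_swap[of a c b] using fix1 unfolding Q(2) .
    then have v: "v = 1" by (rule invariant_leg_cut[OF D' Q(1)])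
    have "u = 1 / sqrt 2" using Q(1) unfolding v by (rule conic_end)
    then have "Q1 = axis_cut a b c" unfolding Q(2) v using axis_cut_swap[of a c b] by simp
    with Q1(2) show ?thesis by contradiction
  qed
qed

section \<open>The quadrisections of the special triangle\<close>

text \<open>The conic expresses \<open>u v\<close> by \<open>u + v\<close>, and \<open>0 \<le> (1 -
  u) (1 - v)\<close> then bounds the sum by \<open>1 + 1 / sqrt 2\<close>. The rational bound
  \<open>12/7\<close> is slightly weaker and sufficient.\<close>
lemma admissible_sum_product:
  assumes "admissible A B C u v"
  shows "4 * (u * v) = 8 * (u + v) - 5 - 2 * (u + v)\<^sup>2" "u + v \<le> 12 / 7"
proof -
  let ?s = "u + v"
  have a: "4 * (u + v - 1)\<^sup>2 = 2 * u\<^sup>2 + 2 * v\<^sup>2 - 1" "u \<le> 1" "v \<le> 1"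
    using assms by (simp_all add: admissible_def)
  show p: "4 * (u * v) = 8 * ?s - 5 - 2 * ?s\<^sup>2" using a(1) by algebra
  have "0 \<le> 4 * ((1 - u) * (1 - v))" using a by simp
  also have "4 * ((1 - u) * (1 - v)) = - (2 * (?s - 12 / 7) * (?s - 2 / 7)) - 1 / 49"
    using p by algebra
  finally have neg: "2 * (?s - 12 / 7) * (?s - 2 / 7) < 0" by simp
  show "?s \<le> 12 / 7"
  proof (rule ccontr)
    assume "\<not> ?s \<le> 12 / 7"
    then have "0 \<le> 2 * (?s - 12 / 7) * (?s - 2 / 7)" by simp
    with neg show False by simp
  qed
qed

text \<open>The perpendicularity condition is symmetric in \<open>u\<close> and \<open>v\<close>
  here, so the conic makes it a quartic equation in \<open>s = u + v\<close>. It has the root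
  \<open>5/3\<close>, and the cofactor is negative on the range of \<open>s\<close>.\<close>
lemma base_cut_unique:
  assumes adm: "admissible b c a u v" and iso: "dist a b = dist a c"
    and ratio: "324 * (dist a b)\<^sup>2 = 337 * (dist b c)\<^sup>2" and "b \<noteq> c"
  shows "u = 5 / 6 \<and> v = 5 / 6"
proof -
  define s where "s = u + v"
  define Z where "Z = (dist b c)\<^sup>2"
  define t where "t = s - 5 / 3"
  have Z: "Z \<noteq> 0" using \<open>b \<noteq> c\<close> by (simp add: Z_def)
  have Y: "(dist a c)\<^sup>2 = 337 / 324 * Z" "(dist a b)\<^sup>2 = 337 / 324 * Z" using ratio iso by (simp_all add: Z_def)
  have "(dist b a)\<^sup>2 + (2 * u\<^sup>2 - 1 - 2 * v\<^sup>2) * ((dist b c)\<^sup>2 + (dist b a)\<^sup>2 - (dist c a)\<^sup>2) / 2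
       = 2 * v\<^sup>2 * (2 * u\<^sup>2 - 1) * (dist b c)\<^sup>2"
    using adm by (simp add: admissible_dist)
  then have "337 / 324 * Z + (2 * u\<^sup>2 - 1 - 2 * v\<^sup>2) * Z / 2 = 2 * v\<^sup>2 * (2 * u\<^sup>2 - 1) * Z"
    by (simp add: dist_commute[of b a] dist_commute[of c a] Y flip: Z_def)
  then have "Z * (u\<^sup>2 + v\<^sup>2 - 4 * (u\<^sup>2 * v\<^sup>2) + 175 / 324) = 0" by (simp add: field_simps)
  then have orth: "u\<^sup>2 + v\<^sup>2 - 4 * (u\<^sup>2 * v\<^sup>2) + 175 / 324 = 0" using Z by simp
  have p: "4 * (u * v) = 8 * s - 5 - 2 * s\<^sup>2" and s: "5 / 3 \<le> s" "s \<le> 12 / 7"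
    using admissible_sum_product[OF adm] admissible_sum_ge[OF adm] by (simp_all add: s_def)
  have "s\<^sup>2 - 2 * (u * v) - 4 * (u * v)\<^sup>2 + 175 / 324 = 0" using orth unfolding s_def by algebra
  then have "t * (4 * t^3 - 16 / 3 * t\<^sup>2 - 52 / 3 * t - 88 / 27) = 0"
    using p unfolding t_def by algebra
  moreover have "4 * t^3 - 16 / 3 * t\<^sup>2 - 52 / 3 * t - 88 / 27 < 0"
  proof -
    have t: "0 \<le> t" "t \<le> 1" using s by (simp_all add: t_def)
    then have "t^3 \<le> t" using power_decreasing[of 1 3 t] by simp
    moreover have "0 \<le> t\<^sup>2" by simp
    ultimately show ?thesis using t by linarith
  qed
  ultimately have "s = 5 / 3" by (simp add: t_def)
  then have "u + v = 5 / 3" "(u - v)\<^sup>2 = 0"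
    using p unfolding s_def by (simp, algebra)
  then show ?thesis by simp
qed

text \<open>The perpendicularity condition is not symmetric in \<open>u\<close> and
  \<open>v\<close>, but on the conic it has the form \<open>E(s) = 52 s (u - v)\<close> with
  \<open>s = u + v\<close> and a polynomial \<open>E\<close>. Squaring it and using the conic for
  \<open>(u - v)\<^sup>2\<close> gives an equation in \<open>s\<close> of degree eight. The axis cut
  contributes the factor \<open>2 s\<^sup>2 - 4 s + 1\<close>, a multiple of \<open>(1 - u) (1 -
  v)\<close>, and the cofactor \<open>R\<close> is negative on the range of
  \<open>s\<close>.\<close>
lemma leg_cut_unique:
  assumes adm: "admissible a b c u v" and iso: "dist a b = dist a c"
    and ratio: "324 * (dist a b)\<^sup>2 = 337 * (dist b c)\<^sup>2" and "b \<noteq> c"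
  shows "u = 1"
proof -
  define s where "s = u + v"
  define p where "p = 4 * (u * v)"
  define Z where "Z = (dist b c)\<^sup>2"
  define t where "t = s - 5 / 3"
  define R where "R = 19421649 - 112413756 * s + 202410950 * s^2 - 165356464 * s^3 + 66778572 * s^4
     - 12719728 * s^5 + 908552 * s^6"
  have Z: "Z \<noteq> 0" using \<open>b \<noteq> c\<close> by (simp add: Z_def)
  have Y: "(dist a c)\<^sup>2 = 337 / 324 * Z" "(dist a b)\<^sup>2 = 337 / 324 * Z" using ratio iso by (simp_all add: Z_def)
  have "(dist a c)\<^sup>2 + (2 * u\<^sup>2 - 1 - 2 * v\<^sup>2) * ((dist a b)\<^sup>2 + (dist a c)\<^sup>2 - (dist b c)\<^sup>2) / 2
       = 2 * v\<^sup>2 * (2 * u\<^sup>2 - 1) * (dist a b)\<^sup>2"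
    using adm by (simp add: admissible_dist)
  then have "337 / 324 * Z + (2 * u\<^sup>2 - 1 - 2 * v\<^sup>2) * (337 / 324 * Z + 337 / 324 * Z - Z) / 2
      = 2 * v\<^sup>2 * (2 * u\<^sup>2 - 1) * (337 / 324 * Z)"
    unfolding Y Z_def[symmetric] .
  then have "Z * (674 * (u\<^sup>2 * v\<^sup>2) - 175 * u\<^sup>2 - 162 * v\<^sup>2 - 81) = 0" by (simp add: field_simps)
  then have orth: "674 * (u\<^sup>2 * v\<^sup>2) - 175 * u\<^sup>2 - 162 * v\<^sup>2 - 81 = 0" using Z by simp
  have ps: "p = 8 * s - 5 - 2 * s\<^sup>2" and s: "5 / 3 \<le> s" "s \<le> 12 / 7"
    using admissible_sum_product[OF adm] admissible_sum_ge[OF adm] by (simp_all add: s_def p_def)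
  have "337 * p\<^sup>2 + 674 * p - 1348 * s\<^sup>2 - 648 = 52 * s * (u - v)"
    using orth unfolding p_def s_def by algebra
  then have "(337 * p\<^sup>2 + 674 * p - 1348 * s\<^sup>2 - 648)\<^sup>2 = 2704 * s\<^sup>2 * (u - v)\<^sup>2"
    by (simp add: power_mult_distrib)
  also have "(u - v)\<^sup>2 = s\<^sup>2 - p" unfolding s_def p_def by algebra
  finally have "(2 * s\<^sup>2 - 4 * s + 1) * R = 0"
    unfolding R_def ps by algebra
  moreover have "R < 0"
  proof -
    have t: "0 \<le> t" "t \<le> 1 / 21" using s by (simp_all add: t_def)
    have st: "s = 5 / 3 + t" by (simp add: t_def)
    \<comment> \<open>Expansion at the left end \<open>5/3\<close> of the range of \<open>s\<close>.\<close>
    have R: "R = - 42081169 / 729 + 8995688 / 27 * t + 131895410 / 27 * t^2 + 287102432 / 27 * t^3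
        - 1362828 * t^4 - 3634208 * t^5 + 908552 * t^6"
      unfolding R_def st by algebra
    have "t^2 \<le> (1 / 21)^2" "t^3 \<le> (1 / 21)^3" using t by (auto intro!: power_mono)
    then have "t^2 \<le> 1 / 441" "t^3 \<le> 1 / 9261" by (simp_all add: power_divide)
    moreover have "t^6 \<le> t^5" "0 \<le> t^5" "0 \<le> t^4" using t by (auto intro!: power_decreasing)
    ultimately show ?thesis unfolding R using t by linarith
  qed
  moreover have "4 * ((1 - u) * (1 - v)) = - (2 * s\<^sup>2 - 4 * s + 1)"
    using ps unfolding p_def s_def by algebra
  ultimately have "u = 1 \<or> v = 1" by auto
  moreover have "v \<noteq> 1"
  proof
    assume v: "v = 1"
    have "4 * (u + v - 1)\<^sup>2 = 2 * u\<^sup>2 + 2 * v\<^sup>2 - 1" using adm by (simp add: admissible_def)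
    then have "u\<^sup>2 = 1 / 2" unfolding v by simp
    then show False using orth unfolding v by simp
  qed
  ultimately show ?thesis by simp
qed

text \<open>The two quadrisections are the axis cut and the symmetric cut on the base. They differ,
  because no end of the latter is the apex.\<close>
lemma card_quadrisections_ratio:
  assumes D: "side a b c \<noteq> 0" and iso: "dist a b = dist a c"
    and ratio: "324 * (dist a b)\<^sup>2 = 337 * (dist b c)\<^sup>2"
  shows "card {Q. quadrisection (convex hull {a, b, c}) Q} = 2"
proof -
  let ?S = "cut_pair b c a (5 / 6) (5 / 6)"
  note iff = quadrisection_triangle_iff[OF D]
  have bc: "b \<noteq> c" using D by (auto simp: side_coords)
  have "admissible b c a (5 / 6) (5 / 6)"
  proof -
    have Y: "(dist b a)\<^sup>2 = 337 / 324 * (dist b c)\<^sup>2" "(dist c a)\<^sup>2 = 337 / 324 * (dist b c)\<^sup>2"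
      using ratio iso by (simp_all add: dist_commute)
    show ?thesis unfolding admissible_dist Y by (simp add: power_divide)
  qed
  then have 1: "quadrisection (convex hull {a, b, c}) ?S" unfolding iff by blast
  have 2: "quadrisection (convex hull {a, b, c}) (axis_cut a b c)"
    unfolding iff using axis_cut_admissible[OF iso] by blast
  have 3: "Q = axis_cut a b c \<or> Q = ?S" if q: "quadrisection (convex hull {a, b, c}) Q" for Q
  proof -
    obtain u v where "admissible a b c u v \<and> Q = cut_pair a b c u v \<or>
        admissible b c a u v \<and> Q = cut_pair b c a u v \<or> admissible c a b u v \<and> Q = cut_pair c a b u v"
      using q unfolding iff by blast
    then show ?thesis
    proof (elim disjE conjE)
      assume adm: "admissible a b c u v" and Q: "Q = cut_pair a b c u v"
      have u: "u = 1" using leg_cut_unique[OF adm iso ratio bc] .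
      then have "v = 1 / sqrt 2" using adm conic_end by blast
      then show ?thesis by (simp add: Q u)
    next
      assume adm: "admissible b c a u v" and Q: "Q = cut_pair b c a u v"
      show ?thesis using base_cut_unique[OF adm iso ratio bc] unfolding Q by blast
    next
      assume "admissible c a b u v" and "Q = cut_pair c a b u v"
      then have adm: "admissible a c b v u" and Q: "Q = cut_pair a c b v u"
        using admissible_swap[of c a b u v] cut_pair_swap[of c a b u v] by simp_all
      have v: "v = 1"
        using leg_cut_unique[OF adm] iso ratio bc by (simp add: dist_commute)
      have "u = 1 / sqrt 2" using adm conic_end unfolding v by blast
      then show ?thesis using axis_cut_swap[of a c b] by (simp add: Q v)
    qed
  qed
  have "axis_cut a b c \<noteq> ?S"
  proof
    assume eq: "axis_cut a b c = ?S"
    have "closed_segment (affine_pt a b c 0 0) (affine_pt a b c (1 / 2) (1 / 2)) \<in> axis_cut a b c"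
      unfolding leg_cut_coords[where a = a and b = b and c = c] by simp
    then show False unfolding eq unfolding base_cut_coords[where a = a and b = b and c = c]
      by (auto simp: doubleton_eq_iff affine_pt_eq_iff[OF D])
  qed
  moreover have "{Q. quadrisection (convex hull {a, b, c}) Q} = {axis_cut a b c, ?S}"
    using 1 2 3 by blast
  ultimately show ?thesis by simp
qed

section \<open>Similarity to the special triangle\<close>

lemma norm_vector_2: "(norm (vector [x, y] :: real^2))\<^sup>2 = x\<^sup>2 + y\<^sup>2"
  unfolding power2_norm_eq_inner by (simp add: inner_vec_def sum_2 power2_eq_square)

text \<open>The similarity takes coordinates along the base and along the axis, in units of the
  base. The factor \<open>9/8\<close> turns the axis vector \<open>e2\<close>, of length
  \<open>8/9\<close> of the base, into a vector of the length of \<open>e1\<close>.\<close>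
lemma similar_I2:
  assumes iso: "dist a b = dist a c"
    and ratio: "324 * (dist a b)\<^sup>2 = 337 * (dist b c)\<^sup>2" and bc: "b \<noteq> c"
  shows "similar (convex hull {a, b, c}) I2"
proof -
  define e1 where "e1 = c - b"
  define e2 where "e2 = a - b - (1/2) *\<^sub>R e1"
  define Z where "Z = e1 \<bullet> e1"
  have Z: "0 < Z" using bc by (simp add: Z_def e1_def)
  have ab: "a - b = e2 + (1/2) *\<^sub>R e1" by (simp add: e2_def)
  have ac: "a - c = e2 - (1/2) *\<^sub>R e1" by (simp add: e2_def e1_def vec_eq_iff field_simps)
  have dab: "(dist a b)\<^sup>2 = e2 \<bullet> e2 + e1 \<bullet> e2 + Z / 4"
    unfolding dist_norm ab power2_norm_eq_inner Z_def
    by (simp add: inner_add_left inner_add_right inner_commute)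
  have dac: "(dist a c)\<^sup>2 = e2 \<bullet> e2 - e1 \<bullet> e2 + Z / 4"
    unfolding dist_norm ac power2_norm_eq_inner Z_def
    by (simp add: inner_diff_left inner_diff_right inner_commute)
  have orth: "e1 \<bullet> e2 = 0" using dab dac iso by simp
  have "(dist b c)\<^sup>2 = Z"
    unfolding Z_def e1_def power2_norm_eq_inner[symmetric] by (simp add: dist_norm norm_minus_commute)
  then have E2: "e2 \<bullet> e2 = 64 / 81 * Z" using ratio dab orth by simp
  define f :: "real^2 \<Rightarrow> real^2" where
    "f z = vector [(z - b) \<bullet> e1 / Z, 9 / 8 * ((z - b) \<bullet> e2) / Z]" for z
  have "dist (f x) (f y) = (1 / sqrt Z) * dist x y" for x y
  proof -
    define d where "d = x - y"
    \<comment> \<open>The theorem of Pythagoras for the orthogonal basis \<open>e1\<close>, \<open>e2\<close> of the plane.\<close>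
    have "(d \<bullet> e1)\<^sup>2 * (e2 \<bullet> e2) + (d \<bullet> e2)\<^sup>2 * (e1 \<bullet> e1) =
        (d \<bullet> d) * (e1 \<bullet> e1) * (e2 \<bullet> e2)"
      using orth by (simp add: inner_vec_def sum_2) algebra
    then have "Z * ((d \<bullet> e1)\<^sup>2 + 81 / 64 * (d \<bullet> e2)\<^sup>2 - (d \<bullet> d) * Z) = 0"
      unfolding E2 Z_def[symmetric] by (simp add: field_simps)
    then have *: "(d \<bullet> e1)\<^sup>2 + 81 / 64 * (d \<bullet> e2)\<^sup>2 = (d \<bullet> d) * Z" using Z by simp
    have "f x - f y = vector [(d \<bullet> e1) / Z, 9 / 8 * (d \<bullet> e2) / Z]"
      by (simp add: f_def d_def vec_eq_iff forall_2 inner_diff_left diff_divide_distrib algebra_simps)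
    then have "(dist (f x) (f y))\<^sup>2 = ((d \<bullet> e1) / Z)\<^sup>2 + (9 / 8 * (d \<bullet> e2) / Z)\<^sup>2"
      unfolding dist_norm by (simp only: norm_vector_2)
    also have "\<dots> = ((d \<bullet> e1)\<^sup>2 + 81 / 64 * (d \<bullet> e2)\<^sup>2) / Z\<^sup>2"
      by (simp add: power_divide power_mult_distrib add_divide_distrib)
    also have "\<dots> = (d \<bullet> d) / Z" unfolding * using Z by (simp add: power2_eq_square)
    also have "\<dots> = ((1 / sqrt Z) * dist x y)\<^sup>2"
      using Z by (simp add: dist_norm d_def power_mult_distrib power_divide power2_norm_eq_inner)
    finally show ?thesis using Z by (simp add: power2_eq_iff_nonneg)
  qed
  then have sim: "similarity f" unfolding similarity_def using Z by (intro exI[of _ "1 / sqrt Z"]) simp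
  have aff: "f (x *\<^sub>R a + y *\<^sub>R b + z *\<^sub>R c) = x *\<^sub>R f a + y *\<^sub>R f b + z *\<^sub>R f c"
    if "x + y + z = 1" for x y z
  proof -
    have y: "y = 1 - x - z" using that by simp
    have diff: "x *\<^sub>R a + y *\<^sub>R b + z *\<^sub>R c - b = x *\<^sub>R (a - b) + z *\<^sub>R (c - b)"
      unfolding y by (simp add: algebra_simps)
    show ?thesis
      unfolding f_def diff by (simp only: inner_add_left inner_scaleR_left)
        (simp add: vec_eq_iff forall_2 add_divide_distrib distrib_left)
  qed
  have "f ` (convex hull {a, b, c}) = convex hull {f a, f b, f c}"
    unfolding convex_hull_3 using aff by (force simp: image_iff)
  also have "f b = vector [0, 0]" by (simp add: f_def)
  also have "f c = vector [1, 0]"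
    using Z orth by (simp add: f_def flip: e1_def Z_def)
  also have "f a = vector [1/2, 8/9]"
    unfolding f_def ab using Z
    by (simp add: inner_add_left inner_commute[of e2 e1] orth E2 flip: Z_def)
  also have "convex hull {vector [1/2, 8/9], vector [0, 0], vector [1, 0]} = I2"
    by (simp add: I2_def insert_commute)
  finally show ?thesis unfolding similar_def using sim by blast
qed

theorem mainTheorem3:
  shows "isosceles_triangle I2 \<and> card {Q. quadrisection I2 Q} = 2 \<and>
    (\<forall>T. isosceles_triangle T \<and> card {Q. quadrisection T Q} = 2 \<longrightarrow> similar T I2)"
proof (intro conjI allI impI)
  define a b c :: "real^2" where "a = vector [1/2, 8/9]" and "b = vector [0, 0]" and "c = vector [1, 0]"
  have I2: "I2 = convex hull {a, b, c}" by (simp add: I2_def a_def b_def c_def insert_commute)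
  have D: "side a b c \<noteq> 0" by (simp add: side_coords a_def b_def c_def)
  have sq: "(dist x y)\<^sup>2 = (x$1 - y$1)\<^sup>2 + (x$2 - y$2)\<^sup>2" for x y :: "real^2"
    unfolding dist_norm power2_norm_eq_inner by (simp add: inner_vec_def sum_2 power2_eq_square)
  have "(dist a b)\<^sup>2 = (dist a c)\<^sup>2" unfolding sq by (simp add: a_def b_def c_def power_divide)
  then have iso: "dist a b = dist a c" by (simp add: power2_eq_iff_nonneg)
  have ratio: "324 * (dist a b)\<^sup>2 = 337 * (dist b c)\<^sup>2"
    unfolding sq by (simp add: a_def b_def c_def power_divide)
  show "isosceles_triangle I2"
    unfolding isosceles_triangle_def using I2 D iso collinear_iff_side by blast
  show "card {Q. quadrisection I2 Q} = 2"
    unfolding I2 using D iso ratio by (rule card_quadrisections_ratio)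
next
  fix T assume T: "isosceles_triangle T \<and> card {Q. quadrisection T Q} = 2"
  then obtain a b c where D: "side a b c \<noteq> 0" and iso: "dist a b = dist a c" and hull: "T = convex hull {a, b, c}"
    unfolding isosceles_triangle_def collinear_iff_side by blast
  have bc: "b \<noteq> c" using D by (auto simp: side_coords)
  have "admissible b c a (5 / 6) (5 / 6)"
    using isosceles_two_quadrisections[OF D iso] T unfolding hull by blast
  then have "(dist b a)\<^sup>2 + (2 * (5/6)\<^sup>2 - 1 - 2 * (5/6)\<^sup>2) * ((dist b c)\<^sup>2 + (dist b a)\<^sup>2 - (dist c a)\<^sup>2) / 2
       = 2 * (5/6)\<^sup>2 * (2 * (5/6)\<^sup>2 - 1) * (dist b c)\<^sup>2"
    unfolding admissible_dist by blast
  then have "324 * (dist a b)\<^sup>2 = 337 * (dist b c)\<^sup>2"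
    using iso by (simp add: dist_commute[of b a] dist_commute[of c a] power_divide field_simps)
  then show "similar T I2" unfolding hull using similar_I2[OF iso _ bc] by blast
qed

end
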